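(* Let $G$ be a finite non-abelian group. Then $\mathcal{GP}(G)$ is complete if and only if $G\cong Q_{2^n}$ for some $n\in\mathbb{N}$.
   Context: For a group $G$, the generalized power graph $\mathcal{GP}(G)$ is the simple undirected graph whose vertices are the non-identity elements of $G$, two distinct vertices $a,b$ being adjacent if and only if $\langle a\rangle\cap\langle b\rangle\neq 1$. A graph is complete if any two distinct vertices are adjacent. $Q_{2^n}$ (defined for $n\ge 3$) is the generalized quaternion group of order $2^n$, $Q_{2^n}=\langle x,y \mid x^{2^{n-1}}=1,\ y^2=x^{2^{n-2}},\ y^{-1}xy=x^{-1}\rangle$. *)

theory Defs
  imports "HOL-Algebra.Algebra"
begin

section \<open>Simple graphs and the generalized power graph\<close>

text \<open>A simple undirected graph is a pair of its vertex set and its set of two-element edges.\<close>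

type_synonym 'a sgraph = "'a set \<times> 'a set set"

definition complete_sgraph :: "'a sgraph \<Rightarrow> bool" where
  "complete_sgraph \<Gamma> \<longleftrightarrow>
     (\<forall>a \<in> fst \<Gamma>. \<forall>b \<in> fst \<Gamma>. a \<noteq> b \<longrightarrow> {a, b} \<in> snd \<Gamma>)"

definition generalized_power_graph :: "('a, 'b) monoid_scheme \<Rightarrow> 'a sgraph" where
  "generalized_power_graph G =
     (carrier G - {\<one>\<^bsub>G\<^esub>},
      {{a, b} | a b. a \<in> carrier G - {\<one>\<^bsub>G\<^esub>} \<and> b \<in> carrier G - {\<one>\<^bsub>G\<^esub>} \<and> a \<noteq> b \<and>
         generate G {a} \<inter> generate G {b} \<noteq> {\<one>\<^bsub>G\<^esub>}})"


section \<open>Groups given by generators and relations\<close>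

text \<open>
  The generators are all elements of the type \<open>'g\<close>. The letter \<open>(g, True)\<close> stands for
  \<open>g\<close>, and \<open>(g, False)\<close> for its formal inverse. A pair \<open>(u, v)\<close> of words
  is the relation \<open>u = v\<close>.
\<close>

type_synonym 'g word = "('g \<times> bool) list"

inductive_set word_cong :: "('g word \<times> 'g word) set \<Rightarrow> ('g word \<times> 'g word) set"
  for R :: "('g word \<times> 'g word) set" where
  refl: "(u, u) \<in> word_cong R"
| sym: "(u, v) \<in> word_cong R \<Longrightarrow> (v, u) \<in> word_cong R"
| trans: "(u, v) \<in> word_cong R \<Longrightarrow> (v, w) \<in> word_cong R \<Longrightarrow> (u, w) \<in> word_cong R"
| append: "(u, u') \<in> word_cong R \<Longrightarrow> (v, v') \<in> word_cong R \<Longrightarrow> (u @ v, u' @ v') \<in> word_cong R"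
| cancel: "([(g, s), (g, \<not> s)], []) \<in> word_cong R"
| relation: "(u, v) \<in> R \<Longrightarrow> (u, v) \<in> word_cong R"

definition presented_group :: "('g word \<times> 'g word) set \<Rightarrow> 'g word set monoid" where
  "presented_group R =
     \<lparr> carrier = UNIV // word_cong R,
       monoid.mult = (\<lambda>A B. \<Union>u\<in>A. \<Union>v\<in>B. word_cong R `` {u @ v}),
       one = word_cong R `` {[]} \<rparr>"

lemma equiv_word_cong: "equiv UNIV (word_cong R)"
  by (auto intro!: equivI refl_onI symI transI
      intro: word_cong.refl word_cong.sym word_cong.trans)

lemma presented_group_carrier: "carrier (presented_group R) = range (\<lambda>u. word_cong R `` {u})"
  by (auto simp: presented_group_def quotient_def)

lemma presented_group_one: "\<one>\<^bsub>presented_group R\<^esub> = word_cong R `` {[]}"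
  by (simp add: presented_group_def)

lemma presented_group_mult:
  "word_cong R `` {u} \<otimes>\<^bsub>presented_group R\<^esub> word_cong R `` {v} = word_cong R `` {u @ v}"
proof -
  have eq: "word_cong R `` {u' @ v'} = word_cong R `` {u @ v}"
    if "u' \<in> word_cong R `` {u}" "v' \<in> word_cong R `` {v}" for u' v'
  proof -
    from that have "(u @ v, u' @ v') \<in> word_cong R"
      by (intro word_cong.append) simp_all
    from equiv_class_eq[OF equiv_word_cong this] show ?thesis by simp
  qed
  have "word_cong R `` {u} \<otimes>\<^bsub>presented_group R\<^esub> word_cong R `` {v}
      = (\<Union>u'\<in>word_cong R `` {u}. \<Union>v'\<in>word_cong R `` {v}. word_cong R `` {u' @ v'})"
    by (simp add: presented_group_def)
  also have "\<dots> = (\<Union>u'\<in>word_cong R `` {u}. \<Union>v'\<in>word_cong R `` {v}. word_cong R `` {u @ v})"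
    by (intro SUP_cong HOL.refl eq)
  also have "\<dots> = word_cong R `` {u @ v}"
    using word_cong.refl[of u R] word_cong.refl[of v R] by (intro equalityI UN_least order_refl) blast
  finally show ?thesis .
qed

lemma word_cong_inverse: "(map (\<lambda>(g, s). (g, \<not> s)) (rev u) @ u, []) \<in> word_cong R"
proof (induction u)
  case Nil
  show ?case by (simp add: word_cong.refl)
next
  case (Cons a u)
  obtain g s where a: "a = (g, s)" by (cases a)
  let ?v = "map (\<lambda>(g, s). (g, \<not> s)) (rev u)"
  have "([(g, \<not> s), (g, s)], []) \<in> word_cong R"
    using word_cong.cancel[of g "\<not> s"] by simp
  then have "(?v @ [(g, \<not> s), (g, s)] @ u, ?v @ [] @ u) \<in> word_cong R"
    by (intro word_cong.append word_cong.refl)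
  with Cons.IH show ?case
    by (auto simp: a intro: word_cong.trans)
qed

lemma group_presented_group: "group (presented_group R)"
proof (rule groupI)
  fix A assume "A \<in> carrier (presented_group R)"
  then obtain u where A: "A = word_cong R `` {u}" by (auto simp: presented_group_carrier)
  have "word_cong R `` {map (\<lambda>(g, s). (g, \<not> s)) (rev u)} \<otimes>\<^bsub>presented_group R\<^esub> A
      = \<one>\<^bsub>presented_group R\<^esub>"
    unfolding A presented_group_one presented_group_mult
    by (rule equiv_class_eq[OF equiv_word_cong word_cong_inverse])
  then show "\<exists>B\<in>carrier (presented_group R).
      B \<otimes>\<^bsub>presented_group R\<^esub> A = \<one>\<^bsub>presented_group R\<^esub>"
    by (auto simp: presented_group_carrier)
qed (auto simp: presented_group_carrier presented_group_one presented_group_mult)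


section \<open>Generalized quaternion groups\<close>

datatype gen = GX | GY

text \<open>
  Only meant for \<open>n \<ge> 3\<close>; the exponents use truncated subtraction.
\<close>

definition gen_quaternion :: "nat \<Rightarrow> gen word set monoid" where
  "gen_quaternion n = presented_group
     {(replicate (2 ^ (n - 1)) (GX, True), []),
      ([(GY, True), (GY, True)], replicate (2 ^ (n - 2)) (GX, True)),
      ([(GY, False), (GX, True), (GY, True)], [(GX, False)])}"

end

theory Submission imports Defs begin

text \<open>
  Completeness forces \<open>G\<close> to be a \<open>p\<close>-group whose elements of order \<open>p\<close> all lie in
  one subgroup \<open>\<langle>z\<rangle>\<close> of order \<open>p\<close>, so that commuting elements generate comparable
  cyclic subgroups. By induction along a chain of subgroups of index \<open>p\<close>, such a group
  is cyclic or generalized quaternion. The key point for \<open>p = 2\<close> is that \<open>h\<^sup>2 = x\<^sup>2\<close> with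
  \<open>h \<notin> \<langle>x\<rangle>\<close> makes \<open>h\<close> invert \<open>h x\<inverse>\<close>, whence \<open>h\<^sup>2 = z\<close>; applied to \<open>g\<close> and
  \<open>g x\<close>, this shows that \<open>g\<close> inverts \<open>x\<close>. For odd \<open>p\<close>, an element \<open>g\<close>
  that normalizes \<open>\<langle>x\<rangle>\<close> with \<open>g\<^sup>p \<in> \<langle>x\<rangle>\<close> commutes with \<open>x\<^sup>p\<close> by induction, so
  \<open>\<langle>g, x\<rangle>\<close> has class at most two, where \<open>p\<close>-th powers are multiplicative.
\<close>

section \<open>Conjugation and cyclic subgroups\<close>

context group
begin

lemma in_cyclic_iff:
  "x \<in> carrier G \<Longrightarrow> y \<in> generate G {x} \<longleftrightarrow> (\<exists>k::int. y = x [^] k)"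
  by (auto simp: generate_pow)

lemma cyclic_subgroup: "x \<in> carrier G \<Longrightarrow> subgroup (generate G {x}) G"
  by (rule generate_is_subgroup) simp

lemma cyclic_closed: "x \<in> carrier G \<Longrightarrow> y \<in> generate G {x} \<Longrightarrow> y \<in> carrier G"
  using generate_in_carrier[of "{x}"] by simp

lemma cyclic_self: "x \<in> generate G {x}"
  by (simp add: generate.incl)

lemma cyclic_pow_mem:
  assumes "x \<in> carrier G"
  shows "x [^] (k::int) \<in> generate G {x}" "x [^] (n::nat) \<in> generate G {x}"
  using assms in_cyclic_iff[of x] by (auto simp: int_pow_int[symmetric])

lemma subgroup_nat_pow_closed:
  "subgroup H G \<Longrightarrow> x \<in> H \<Longrightarrow> x [^] (n::nat) \<in> H"
  by (metis int_pow_int subgroup_int_pow_closed)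

lemma cyclic_mono:
  assumes "x \<in> carrier G" "y \<in> generate G {x}"
  shows "generate G {y} \<subseteq> generate G {x}"
  using assms by (intro generate_subgroup_incl cyclic_subgroup) auto

lemma cyclic_commute:
  assumes "x \<in> carrier G" "y \<in> generate G {x}" "z \<in> generate G {x}"
  shows "y \<otimes> z = z \<otimes> y"
  using assms by (auto simp: in_cyclic_iff int_pow_mult[symmetric] add.commute)

lemma conj_hom:
  assumes "g \<in> carrier G"
  shows "group_hom G G (\<lambda>x. inv g \<otimes> x \<otimes> g)"
proof unfold_locales
  have "inv g \<otimes> (x \<otimes> y) \<otimes> g = (inv g \<otimes> x \<otimes> g) \<otimes> (inv g \<otimes> y \<otimes> g)"
    if "x \<in> carrier G" "y \<in> carrier G" for x y
    using assms that by (simp add: m_assoc) (simp add: m_assoc[symmetric])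
  then show "(\<lambda>x. inv g \<otimes> x \<otimes> g) \<in> hom G G"
    using assms by (auto simp: hom_def)
qed

lemma conj_int_pow:
  assumes "g \<in> carrier G" "x \<in> carrier G"
  shows "inv g \<otimes> x [^] (k::int) \<otimes> g = (inv g \<otimes> x \<otimes> g) [^] k"
  using group_hom.hom_int_pow[OF conj_hom[OF assms(1)] assms(2)] by simp

lemma conj_nat_pow:
  assumes "g \<in> carrier G" "x \<in> carrier G"
  shows "inv g \<otimes> x [^] (n::nat) \<otimes> g = (inv g \<otimes> x \<otimes> g) [^] n"
  using conj_int_pow[OF assms, of "int n"] by (simp add: int_pow_int)

lemma commute_iff_conj:
  assumes "g \<in> carrier G" "x \<in> carrier G"
  shows "g \<otimes> x = x \<otimes> g \<longleftrightarrow> inv g \<otimes> x \<otimes> g = x"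
  using assms by (metis inv_closed inv_solve_left m_assoc m_closed)

lemma conj_commute:
  assumes "g \<in> carrier G" "x \<in> carrier G" "g \<otimes> x = x \<otimes> g"
  shows "inv g \<otimes> x \<otimes> g = x"
  using assms commute_iff_conj by blast

lemma commute_cyclic:
  assumes "g \<in> carrier G" "x \<in> carrier G" "g \<otimes> x = x \<otimes> g" "y \<in> generate G {x}"
  shows "g \<otimes> y = y \<otimes> g"
proof -
  obtain k :: int where y: "y = x [^] k" using assms in_cyclic_iff by blast
  have "inv g \<otimes> y \<otimes> g = y"
    using conj_int_pow[of g x k] conj_commute[OF assms(1-3)] assms y by simp
  then show ?thesis using assms commute_iff_conj y by simp
qed

text \<open>The commutator \<open>e\<close> of \<open>u\<close> and \<open>g\<close> is central in
  the group they generate. Moving each \<open>g\<close> left across \<open>u^m\<close> costs a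
  factor \<open>e^m\<close>, and 0 + 1 + ... + (n - 1) = n (n - 1) / 2.\<close>

lemma class_two_pow:
  assumes c: "g \<in> carrier G" "u \<in> carrier G" "e \<in> carrier G"
    and ug: "u \<otimes> g = g \<otimes> u \<otimes> e" and eg: "e \<otimes> g = g \<otimes> e" and eu: "e \<otimes> u = u \<otimes> e"
  shows "(g \<otimes> u) [^] (n::nat) = g [^] n \<otimes> u [^] n \<otimes> e [^] (n * (n - 1) div 2)"
proof (induction n)
  case 0
  show ?case using c by simp
next
  case (Suc n)
  let ?T = "n * (n - 1) div 2"
  have epg: "e [^] m \<otimes> g = g \<otimes> e [^] m" and epu: "e [^] m \<otimes> u = u \<otimes> e [^] m"
    for m :: nat
    using c eg eu by (auto intro: group_commutes_pow)
  have upg: "u [^] m \<otimes> g = g \<otimes> u [^] m \<otimes> e [^] m" for m :: nat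
  proof (induction m)
    case 0
    show ?case using c by simp
  next
    case (Suc m)
    have "u [^] Suc m \<otimes> g = u [^] m \<otimes> (u \<otimes> g)" using c by (simp add: m_assoc)
    also have "\<dots> = (u [^] m \<otimes> g) \<otimes> (u \<otimes> e)" using c ug by (simp add: m_assoc)
    also have "\<dots> = g \<otimes> u [^] m \<otimes> (e [^] m \<otimes> u) \<otimes> e" using c Suc by (simp add: m_assoc)
    also have "\<dots> = g \<otimes> u [^] Suc m \<otimes> e [^] Suc m" using c epu by (simp add: m_assoc)
    finally show ?case .
  qed
  have epu2: "e [^] m \<otimes> (u \<otimes> w) = u \<otimes> (e [^] m \<otimes> w)"
    if "w \<in> carrier G" for w and m :: nat
    using epu[of m] c that m_assoc by (metis nat_pow_closed)
  have T: "Suc n * (Suc n - 1) div 2 = n + ?T"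
    by (cases n) (simp_all add: algebra_simps)
  have "(g \<otimes> u) [^] Suc n = g [^] n \<otimes> u [^] n \<otimes> (e [^] ?T \<otimes> g) \<otimes> u"
    using c Suc by (simp add: m_assoc)
  also have "\<dots> = g [^] n \<otimes> (u [^] n \<otimes> g) \<otimes> (e [^] ?T \<otimes> u)"
    using c epg by (simp add: m_assoc)
  also have "\<dots> = g [^] n \<otimes> (g \<otimes> u [^] n) \<otimes> (e [^] n \<otimes> u) \<otimes> e [^] ?T"
    using c epu epu2 upg by (simp add: m_assoc)
  also have "\<dots> = g [^] n \<otimes> (g \<otimes> u [^] n) \<otimes> u \<otimes> (e [^] n \<otimes> e [^] ?T)"
    using c epu by (simp add: m_assoc)
  also have "\<dots> = g [^] Suc n \<otimes> u [^] Suc n \<otimes> e [^] (n + ?T)"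
    using c by (simp add: m_assoc nat_pow_mult)
  finally show ?case using T by simp
qed

text \<open>\<open>H\<close> consists of only \<open>p\<close> left cosets of \<open>M\<close>, so
  two of the \<open>p + 1\<close> elements share one; the count runs over the products
  \<open>a i \<otimes> m\<close>.\<close>

lemma pigeonhole_cosets:
  assumes fin: "finite (carrier G)" and M: "subgroup M G" and H: "subgroup H G" "M \<subseteq> H"
    and card: "card H = p * card M" and a: "\<And>i. i \<le> p \<Longrightarrow> a i \<in> H"
  shows "\<exists>i j. i < j \<and> j \<le> p \<and> inv (a i) \<otimes> a j \<in> M"
proof (rule ccontr)
  assume no: "\<not> ?thesis"
  interpret M: subgroup M G by fact
  interpret H: subgroup H G by fact
  have finH: "finite H" and finM: "finite M"
    using fin H.subset M.subset finite_subset by blast+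
  have key: "inv (a i) \<otimes> a j \<in> M" if "i \<le> p" "j \<le> p" "m \<in> M" "m' \<in> M" "a i \<otimes> m = a j \<otimes> m'" for i j m m'
  proof -
    have c: "a i \<in> carrier G" "a j \<in> carrier G" "m \<in> carrier G" "m' \<in> carrier G"
      using that a H.mem_carrier by auto
    have "a j = a i \<otimes> (m \<otimes> inv m')"
      using that(5) c by (metis inv_closed inv_solve_right m_assoc m_closed)
    then have "inv (a i) \<otimes> a j = m \<otimes> inv m'"
      using c by (metis inv_closed inv_solve_left m_closed)
    then show ?thesis using that by simp
  qed
  have "inj_on (\<lambda>(i, m). a i \<otimes> m) ({..p} \<times> M)"
  proof -
    have "i = j \<and> m = m'"
      if *: "i \<le> p" "m \<in> M" "j \<le> p" "m' \<in> M" "a i \<otimes> m = a j \<otimes> m'" for i m j m'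
    proof -
      have "i = j"
        using key[of i j m m'] key[of j i m' m] * no by (cases i j rule: linorder_cases) auto
      then show ?thesis
        using * a[of i] by (metis H.mem_carrier M.mem_carrier l_cancel)
    qed
    then show ?thesis by (auto simp: inj_on_def)
  qed
  moreover have "(\<lambda>(i, m). a i \<otimes> m) ` ({..p} \<times> M) \<subseteq> H"
    using a H.m_closed assms(4) by auto
  ultimately have "card ({..p} \<times> M) \<le> card H"
    using finH card_inj_on_le by blast
  moreover have "card M > 0" using finM M.one_closed card_gt_0_iff by blast
  ultimately show False using card by (simp add: card_cartesian_product)
qed


lemma inverted_cyclic:
  assumes "y \<in> carrier G" "x \<in> carrier G" "inv y \<otimes> x \<otimes> y = inv x" "v \<in> generate G {x}"
  shows "inv y \<otimes> v \<otimes> y = inv v"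
  using assms conj_int_pow[of y x] by (auto simp: in_cyclic_iff int_pow_inv)

lemma conj_mult:
  assumes "a \<in> carrier G" "b \<in> carrier G" "x \<in> carrier G"
  shows "inv (a \<otimes> b) \<otimes> x \<otimes> (a \<otimes> b) = inv b \<otimes> (inv a \<otimes> x \<otimes> a) \<otimes> b"
  using assms by (simp add: inv_mult_group m_assoc)

lemma subgroup_lcancel:
  assumes "subgroup H G" "h \<in> H" "a \<in> carrier G" "h \<otimes> a \<in> H"
  shows "a \<in> H"
proof -
  have "inv h \<otimes> (h \<otimes> a) \<in> H"
    using assms subgroup.m_closed subgroup.m_inv_closed by metis
  then show ?thesis using assms by (simp add: m_assoc[symmetric] subgroup.mem_carrier)
qed

lemma subgroup_rcancel:
  assumes "subgroup H G" "h \<in> H" "a \<in> carrier G" "a \<otimes> h \<in> H"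
  shows "a \<in> H"
proof -
  have "(a \<otimes> h) \<otimes> inv h \<in> H"
    using assms subgroup.m_closed subgroup.m_inv_closed by metis
  then show ?thesis using assms by (simp add: m_assoc subgroup.mem_carrier)
qed

lemma pow_two: "x \<in> carrier G \<Longrightarrow> x [^] (2::nat) = x \<otimes> x"
  by (simp add: numeral_2_eq_2)

text \<open>Pigeonhole on \<open>\<one>\<close>, \<open>g\<close>, \<open>h\<close>: neither
  \<open>g\<close> nor \<open>h\<close> lies in the coset of \<open>\<one>\<close>, so they share
  the other one.\<close>

lemma index_two_coset:
  assumes "finite (carrier G)" "subgroup M G" "subgroup H G" "M \<subseteq> H" "card H = 2 * card M"
    and g: "g \<in> H" "g \<notin> M" and h: "h \<in> H" "h \<notin> M"
  shows "inv g \<otimes> h \<in> M"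
proof -
  define a where "a = (\<lambda>i::nat. if i = 0 then \<one> else if i = 1 then g else h)"
  have "a i \<in> H" for i using g h assms(3) by (simp add: a_def subgroup.one_closed)
  then obtain i j where ij: "i < j" "j \<le> 2" "inv (a i) \<otimes> a j \<in> M"
    using pigeonhole_cosets[OF assms(1-5), of a] by blast
  have c: "g \<in> carrier G" "h \<in> carrier G" using g h assms(3) subgroup.mem_carrier by metis+
  have "(i = 0 \<and> j = 1) \<or> (i = 0 \<and> j = 2) \<or> (i = 1 \<and> j = 2)" using ij by auto
  then show ?thesis using ij(3) c g h by (auto simp: a_def)
qed

end

section \<open>Groups with a unique subgroup of prime order\<close>

text \<open>The p-group condition is put on element orders, the form in which completeness yields
  it; for the order of the whole group it is derived later.\<close>

locale unique_order_p_group = group G for G :: "('a, 'b) monoid_scheme" (structure) +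
  fixes p :: nat and z :: 'a
  assumes finite_carrier: "finite (carrier G)"
    and prime_p: "Factorial_Ring.prime p"
    and z_closed: "z \<in> carrier G"
    and z_nontrivial: "z \<noteq> \<one>"
    and z_pow_p: "z [^] p = \<one>"
    and ord_prime_power: "g \<in> carrier G \<Longrightarrow> \<exists>k. ord g = p ^ k"
    and order_p_in_z: "g \<in> carrier G \<Longrightarrow> g [^] p = \<one> \<Longrightarrow> g \<in> generate G {z}"
begin

lemma coprime_power_generates:
  assumes "x \<in> carrier G" "\<not> int p dvd m"
  shows "x \<in> generate G {x [^] m}"
proof -
  obtain k where k: "ord x = p ^ k" using ord_prime_power assms by blast
  have "coprime m (int (ord x))"
    using assms(2) prime_p prime_imp_coprime[of "int p" m] by (simp add: k coprime_commute)
  then obtain u v where uv: "u * m + v * int (ord x) = 1"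
    using bezout_int[of m "int (ord x)"] by auto
  have "x = x [^] (u * m + v * int (ord x))" using uv assms by simp
  also have "\<dots> = x [^] (u * m) \<otimes> x [^] (v * int (ord x))" using assms by (simp add: int_pow_mult)
  also have "x [^] (v * int (ord x)) = \<one>" using assms by (subst int_pow_eq_id) auto
  also have "x [^] (u * m) = (x [^] m) [^] u" using assms by (simp add: int_pow_pow mult.commute)
  finally have "x = (x [^] m) [^] u" using assms by simp
  then show ?thesis using assms by (metis cyclic_pow_mem(1) int_pow_closed)
qed

text \<open>Write \<open>g^p = x^m\<close>. If \<open>p\<close> does not divide \<open>m\<close>,
  then \<open>x^m\<close> generates \<open>x\<close>; otherwise \<open>g\<close> and a power of
  \<open>x\<close> have the same \<open>p\<close>-th power, and their quotient is a candidate for an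
  element of order \<open>p\<close>.\<close>

lemma pth_root_cases:
  assumes "x \<in> carrier G" "g \<in> carrier G" "g [^] p \<in> generate G {x}"
  shows "x \<in> generate G {g} \<or> (\<exists>l::int. g [^] p = (x [^] l) [^] p)"
proof -
  obtain m :: int where m: "g [^] p = x [^] m" using assms in_cyclic_iff by blast
  show ?thesis
  proof (cases "int p dvd m")
    case True
    then obtain l where "m = int p * l" by auto
    then have "x [^] m = (x [^] l) [^] p"
      using assms by (simp add: int_pow_int[symmetric] int_pow_pow mult.commute)
    then show ?thesis using m by metis
  next
    case False
    then have "x \<in> generate G {g [^] p}"
      using coprime_power_generates[of x m] assms m by simp
    then show ?thesis using cyclic_mono[of g "g [^] p"] cyclic_pow_mem assms by blast
  qed
qed

text \<open>If \<open>ord x = p^(j + 1)\<close>, then \<open>x^(p^j)\<close> is a nontrivial power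
  of \<open>z\<close>; as \<open>z\<close> has prime order, it is in turn a power of
  \<open>x^(p^j)\<close>.\<close>

lemma z_in_cyclic:
  assumes "x \<in> carrier G" "x \<noteq> \<one>"
  shows "z \<in> generate G {x}"
proof -
  obtain k where k: "ord x = p ^ k" using ord_prime_power assms by blast
  have "k \<noteq> 0" using assms k ord_eq_1[of x] by (intro notI) simp
  then obtain j where j: "k = Suc j" using not0_implies_Suc by blast
  define y where "y = x [^] (p ^ j)"
  have yc: "y \<in> carrier G" using assms y_def by simp
  have "y [^] p = \<one>" using assms k j by (simp add: y_def nat_pow_pow pow_eq_id)
  then obtain m :: int where m: "y = z [^] m" using order_p_in_z yc in_cyclic_iff z_closed by blast
  have "\<not> p ^ Suc j dvd p ^ j" using prime_p by (auto simp: prime_gt_1_nat dest!: dvd_imp_le)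
  then have "y \<noteq> \<one>" using assms k j by (simp add: y_def pow_eq_id)
  have "ord z = p" using prime_p z_pow_p z_nontrivial z_closed
    ord_eq_1[OF z_closed] by (auto simp: prime_nat_iff pow_eq_id)
  then have "\<not> int p dvd m" using m \<open>y \<noteq> \<one>\<close> z_closed by (simp add: int_pow_eq_id)
  then have "z \<in> generate G {y}" using coprime_power_generates m z_closed by metis
  then show ?thesis using cyclic_mono[of x y] cyclic_pow_mem(2) assms y_def by blast
qed

lemma order_p_in_cyclic:
  assumes "x \<in> carrier G" "x \<noteq> \<one>" "g \<in> carrier G" "g [^] p = \<one>"
  shows "g \<in> generate G {x}"
  using order_p_in_z[of g] z_in_cyclic[of x] cyclic_mono[of x z] assms by blast

text \<open>This is the fact that an abelian p-group with one subgroup of order \<open>p\<close> is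
  cyclic, for two elements. The last term \<open>c\<close> of \<open>g\<close>, \<open>g^p\<close>,
  \<open>g^(p^2)\<close>, ... outside \<langle>x\<rangle> has its \<open>p\<close>-th power inside.
  If \<open>c^p = y^p\<close> for a power \<open>y\<close> of \<open>x\<close>, then
  \<open>c y\<inverse>\<close> is killed by \<open>p\<close> and falls into \<langle>x\<rangle>,
  taking \<open>c\<close> along.\<close>

lemma commuting_cyclic_comparable:
  assumes x: "x \<in> carrier G" and g: "g \<in> carrier G" and comm: "g \<otimes> x = x \<otimes> g"
  shows "g \<in> generate G {x} \<or> x \<in> generate G {g}"
proof (cases "g \<in> generate G {x} \<or> x = \<one>")
  case True
  then show ?thesis using generate.one by metis
next
  case False
  obtain k where k: "ord g = p ^ k" using ord_prime_power g by blast
  define s where "s = (LEAST s. g [^] (p ^ s) \<in> generate G {x})"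
  have "g [^] (p ^ k) \<in> generate G {x}" using k g pow_ord_eq_1 generate.one by metis
  then have s: "g [^] (p ^ s) \<in> generate G {x}" unfolding s_def by (rule LeastI)
  have "s \<noteq> 0" using False s g by (intro notI) simp
  then obtain t where t: "s = Suc t" using not0_implies_Suc by blast
  define c where "c = g [^] (p ^ t)"
  have c: "c \<in> carrier G" "c \<in> generate G {g}" using g c_def cyclic_pow_mem by auto
  have cx: "c \<notin> generate G {x}"
    using not_less_Least[of t "\<lambda>s. g [^] (p ^ s) \<in> generate G {x}"] t by (simp add: c_def s_def)
  have cp: "c [^] p \<in> generate G {x}" using s t g by (simp add: c_def nat_pow_pow mult.commute)
  have "x \<otimes> c = c \<otimes> x" using commute_cyclic[OF x g comm[symmetric] c(2)] .
  from pth_root_cases[OF x c(1) cp] show ?thesis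
  proof
    assume "x \<in> generate G {c}"
    then show ?thesis using cyclic_mono[OF g c(2)] by blast
  next
    assume "\<exists>l::int. c [^] p = (x [^] l) [^] p"
    then obtain l :: int where l: "c [^] p = (x [^] l) [^] p" by blast
    define y where "y = x [^] l"
    have y: "y \<in> carrier G" "y \<in> generate G {x}" using x y_def cyclic_pow_mem by auto
    have cy: "c \<otimes> y = y \<otimes> c" using commute_cyclic[OF c(1) x _ y(2)] \<open>x \<otimes> c = c \<otimes> x\<close> by simp
    have "inv y \<otimes> c = c \<otimes> inv y"
      using commute_cyclic[OF c(1) y(1) cy, of "inv y"] generate.inv[of y "{y}" G] by simp
    then have "(c \<otimes> inv y) [^] p = c [^] p \<otimes> inv y [^] p"
      using y c by (simp add: pow_mult_distrib)
    also have "\<dots> = \<one>" using l y c by (simp add: y_def[symmetric] nat_pow_inv)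
    finally have "c \<otimes> inv y \<in> generate G {x}"
      using False x y c by (intro order_p_in_cyclic) auto
    moreover have "inv y \<in> generate G {x}"
      using y x cyclic_subgroup subgroup.m_inv_closed by metis
    ultimately have "c \<in> generate G {x}"
      using subgroup_rcancel[OF cyclic_subgroup[OF x]] c by blast
    then show ?thesis using cx by blast
  qed
qed

lemma z_central: "g \<in> carrier G \<Longrightarrow> g \<otimes> z = z \<otimes> g"
  by (cases "g = \<one>") (auto simp: z_closed intro: cyclic_commute[of g] cyclic_self z_in_cyclic)


section \<open>The prime two: squares and inversion\<close>

lemma involution_eq_z:
  assumes "p = 2" "g \<in> carrier G" "g \<otimes> g = \<one>" "g \<noteq> \<one>"
  shows "g = z"
proof -
  have "g [^] p = \<one>" using assms by (simp add: pow_two)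
  then obtain k :: int where k: "g = z [^] k" using order_p_in_z assms in_cyclic_iff z_closed by blast
  have zz: "z [^] (2 * j) = \<one>" for j :: int
    using z_pow_p assms(1) z_closed by (simp add: int_pow_pow[symmetric] int_pow_int[of _ _ 2, simplified])
  obtain j where "k = 2 * j \<or> k = 2 * j + 1" by (meson evenE oddE)
  then show ?thesis using k zz[of j] z_closed assms by (auto simp: int_pow_mult)
qed

lemma ord_nonzero: "g \<in> carrier G \<Longrightarrow> ord g \<noteq> 0"
  using ord_prime_power[of g] prime_p by (metis not_prime_0 power_not_zero)

text \<open>The element \<open>w = h^2 = x^2\<close> commutes with \<open>d = h x\<inverse>\<close>,
  which lies outside \<langle>x\<rangle>, so comparability puts \<open>w\<close> into
  \<langle>d\<rangle>. As \<open>h\<close> inverts \<open>d\<close>, it inverts \<open>w\<close>,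
  yet it commutes with its own square; hence \<open>w^2 = 1\<close>.\<close>

lemma equal_squares:
  assumes p: "p = 2" and c: "h \<in> carrier G" "x \<in> carrier G" and x: "x \<noteq> \<one>"
    and h: "h \<notin> generate G {x}" and hx: "h \<otimes> h = x \<otimes> x"
  shows "h \<otimes> h = z"
proof -
  define d w where "d = h \<otimes> inv x" and "w = h \<otimes> h"
  have cd: "d \<in> carrier G" and cw: "w \<in> carrier G" using c d_def w_def by auto
  interpret X: subgroup "generate G {x}" G using c by (intro cyclic_subgroup)
  have wx: "w \<in> generate G {x}" using hx w_def cyclic_self by simp
  have dx: "d \<notin> generate G {x}"
    using h c subgroup_rcancel[OF X.subgroup_axioms, of "inv x" h] cyclic_self
    by (auto simp: d_def)
  have "inv x \<otimes> h = inv x \<otimes> (h \<otimes> h) \<otimes> inv h" using c by (simp add: m_assoc)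
  also have "\<dots> = x \<otimes> inv h" unfolding hx using c by (simp add: m_assoc[symmetric])
  finally have "inv h \<otimes> d \<otimes> h = inv d"
    using c by (simp add: d_def m_assoc[symmetric] inv_mult_group)
  note inverts = this
  have "inv x \<otimes> w = w \<otimes> inv x" using cyclic_commute[OF c(2) _ wx] cyclic_self by simp
  then have "d \<otimes> w = w \<otimes> d"
    using c cw by (simp add: d_def m_assoc) (simp add: w_def m_assoc)
  then have "d \<in> generate G {w} \<or> w \<in> generate G {d}"
    using commuting_cyclic_comparable cd cw by blast
  then have "w \<in> generate G {d}" using dx wx cyclic_mono[OF c(2)] by blast
  then have "inv h \<otimes> w \<otimes> h = inv w" using inverted_cyclic[OF c(1) cd inverts] by blast
  moreover have "inv h \<otimes> w \<otimes> h = w" using c by (simp add: w_def m_assoc[symmetric])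
  ultimately have "w \<otimes> w = \<one>" using cw by (metis r_inv)
  moreover have "w \<noteq> \<one>"
    using order_p_in_cyclic[OF c(2) x c(1)] h c p by (auto simp: w_def pow_two)
  ultimately show ?thesis using involution_eq_z p cw w_def by blast
qed

text \<open>Without commutation \<open>x\<close> is no power of \<open>h\<close>, so
  \<open>pth_root_cases\<close> yields a power of \<open>x\<close> with the same square as
  \<open>h\<close>, to which \<open>equal_squares\<close> applies.\<close>

lemma square_in_cyclic:
  assumes p: "p = 2" and c: "x \<in> carrier G" "h \<in> carrier G" and h: "h \<notin> generate G {x}"
    and sq: "h \<otimes> h \<in> generate G {x}" and nc: "h \<otimes> x \<noteq> x \<otimes> h"
  shows "h \<otimes> h = z"
proof -
  have "x \<notin> generate G {h}" using nc cyclic_commute[OF c(2) cyclic_self, of x] by blast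
  then obtain l :: int where l: "h \<otimes> h = (x [^] l) \<otimes> (x [^] l)"
    using pth_root_cases[OF c] sq p c by (auto simp: pow_two)
  have sub: "generate G {x [^] l} \<subseteq> generate G {x}" using cyclic_mono cyclic_pow_mem c by blast
  have x: "x \<noteq> \<one>" using nc c by auto
  have "x [^] l \<noteq> \<one>"
    using order_p_in_cyclic[OF c(1) x c(2)] l h c p by (auto simp: pow_two)
  then show ?thesis using equal_squares[OF p c(2) _ _ _ l] c h sub by blast
qed

lemma noncommuting_inverts:
  assumes p: "p = 2" and c: "x \<in> carrier G" "g \<in> carrier G" and g: "g \<notin> generate G {x}"
    and sq: "g \<otimes> g \<in> generate G {x}" "(g \<otimes> x) \<otimes> (g \<otimes> x) \<in> generate G {x}"
    and nc: "g \<otimes> x \<noteq> x \<otimes> g"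
  shows "g \<otimes> g = z" "inv g \<otimes> x \<otimes> g = inv x"
proof -
  show gz: "g \<otimes> g = z" using square_in_cyclic[OF p c g sq(1) nc] .
  have "g \<otimes> x \<notin> generate G {x}"
    using g c subgroup_rcancel[OF cyclic_subgroup, of x x g] cyclic_self by blast
  moreover have "(g \<otimes> x) \<otimes> x \<noteq> x \<otimes> (g \<otimes> x)"
    using nc c by (metis m_assoc m_closed r_cancel)
  ultimately have "(g \<otimes> x) \<otimes> (g \<otimes> x) = z"
    using square_in_cyclic[OF p c(1) _ _ sq(2)] c by simp
  then have "g \<otimes> (x \<otimes> g \<otimes> x) = g \<otimes> g" using gz c by (simp add: m_assoc)
  then have "x \<otimes> g \<otimes> x = g" using c by simp
  then have "inv g \<otimes> (x \<otimes> g \<otimes> x) = \<one>" using c by simp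
  then have "(inv g \<otimes> x \<otimes> g) \<otimes> x = \<one>" using c by (simp add: m_assoc)
  then show "inv g \<otimes> x \<otimes> g = inv x" using c inv_equality[of _ x] by simp
qed

section \<open>Odd primes: elements normalizing a cyclic subgroup\<close>

text \<open>Induction descends from \<open>x\<close> to \<open>x^p\<close>. As \<open>g\<close>
  commutes with \<open>x^p\<close>, the commutator of \<open>x\<close> and \<open>g\<close> is
  killed by \<open>p\<close> and commutes with both. Some \<open>g u\<close> with \<open>u\<close> a
  power of \<open>x\<close> is then killed by \<open>p\<close>, which forces \<open>g\<close> into
  \<langle>x\<rangle>.\<close>

lemma odd_normalizer_commutes:
  assumes p: "p \<noteq> 2" and c: "x \<in> carrier G" "g \<in> carrier G"
    and norm: "inv g \<otimes> x \<otimes> g \<in> generate G {x}" and gp: "g [^] p \<in> generate G {x}"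
  shows "g \<otimes> x = x \<otimes> g"
  using c norm gp
proof (induction "ord x" arbitrary: x rule: less_induct)
  case less
  note c = less.prems(1,2) and norm = less.prems(3) and gp = less.prems(4)
  interpret X: subgroup "generate G {x}" G using c by (intro cyclic_subgroup)
  show ?case
  proof (rule ccontr)
    assume nc: "g \<otimes> x \<noteq> x \<otimes> g"
    have gx: "g \<notin> generate G {x}" using nc cyclic_commute[OF c(1) _ cyclic_self, of g] by blast
    have "x \<notin> generate G {g}" using nc cyclic_commute[OF c(2) cyclic_self, of x] by blast
    then obtain l :: int where l: "g [^] p = (x [^] l) [^] p"
      using pth_root_cases[OF c gp] by blast
    have x1: "x \<noteq> \<one>" using nc c by auto
    \<comment> \<open>In this form \<open>g^p\<close> lies in the subgroup generated by
      \<open>x^p\<close>, as the induction hypothesis requires.\<close>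
    have lp: "g [^] p = (x [^] p) [^] l"
      using l c by (simp add: int_pow_int[symmetric] int_pow_pow mult.commute)
    have xp1: "x [^] p \<noteq> \<one>" using order_p_in_cyclic[OF c(1) x1 c(2)] gx lp by auto
    have xp: "x [^] p \<in> carrier G" using c by simp
    have "p dvd ord x"
    proof -
      obtain k where k: "ord x = p ^ k" using ord_prime_power c by blast
      then have "k \<noteq> 0" using x1 c ord_eq_1[of x] by (intro notI) simp
      then show ?thesis using k by (simp add: dvd_power)
    qed
    then have "ord (x [^] p) = ord x div p" using c prime_p ord_pow[of x p] by (metis not_prime_0)
    then have lt: "ord (x [^] p) < ord x"
      using ord_nonzero[OF c(1)] prime_gt_1_nat[OF prime_p] by simp
    define t where "t = inv g \<otimes> x \<otimes> g"
    have t: "t \<in> carrier G" "t \<in> generate G {x}" using norm c t_def by auto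
    obtain r :: int where r: "t = x [^] r" using t(2) in_cyclic_iff c by blast
    have "inv g \<otimes> x [^] p \<otimes> g = (x [^] p) [^] r"
      using conj_nat_pow[of g x p] c r t_def
      by (simp add: int_pow_int[symmetric] int_pow_pow mult.commute)
    then have comm: "g \<otimes> x [^] p = x [^] p \<otimes> g"
      using less.hyps[OF lt xp c(2)] lp cyclic_pow_mem(1)[OF xp] by metis
    then have tp: "t [^] p = x [^] p"
      using conj_nat_pow[of g x p] conj_commute[OF c(2) xp] c t_def by simp
    \<comment> \<open>The commutator of \<open>x\<close> and \<open>g\<close>; its
      \<open>p\<close>-th power is 1 because conjugation by \<open>g\<close> fixes
      \<open>x^p\<close>.\<close>
    define e where "e = inv x \<otimes> t"
    have ex: "e \<in> generate G {x}" using t(2) cyclic_self by (simp add: e_def)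
    have ec: "e \<in> carrier G" using ex X.mem_carrier by blast
    have te: "t = x \<otimes> e" using c t by (simp add: e_def m_assoc[symmetric])
    have xt: "inv x \<otimes> t = t \<otimes> inv x" using cyclic_commute[OF c(1)] t(2) cyclic_self by simp
    have ep: "e [^] p = \<one>"
      using pow_mult_distrib[OF xt] c t tp by (simp add: e_def nat_pow_inv)
    have "e \<in> generate G {x [^] p}" using order_p_in_cyclic[OF xp xp1 ec ep] .
    then have ge: "g \<otimes> e = e \<otimes> g" using commute_cyclic[OF c(2) xp comm] by blast
    have xe: "x \<otimes> e = e \<otimes> x" using cyclic_commute[OF c(1) cyclic_self ex] .
    \<comment> \<open>\<open>u\<close> is chosen so that \<open>u^p\<close> is the inverse of
      \<open>g^p\<close>; \<open>f\<close> is the commutator of \<open>u\<close> and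
      \<open>g\<close>.\<close>
    define u f where "u = x [^] (- l)" and "f = e [^] (- l)"
    have uc: "u \<in> carrier G" "u \<in> generate G {x}" and fc: "f \<in> carrier G" "f \<in> generate G {e}"
      using c ec cyclic_pow_mem by (auto simp: u_def f_def)
    have "inv g \<otimes> u \<otimes> g = u \<otimes> f"
      using conj_int_pow[OF c(2,1), of "- l"] int_pow_mult_distrib[OF xe c(1) ec] te
      by (simp add: u_def f_def t_def)
    then have ug: "u \<otimes> g = g \<otimes> u \<otimes> f"
      using c uc fc by (metis inv_closed inv_solve_left m_assoc m_closed)
    have fg: "f \<otimes> g = g \<otimes> f" using commute_cyclic[OF c(2) ec ge fc(2)] by simp
    have "f \<in> generate G {x}" using cyclic_mono[OF c(1) ex] fc by blast
    then have fu: "f \<otimes> u = u \<otimes> f" using cyclic_commute[OF c(1)] uc by blast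
    have fp: "f [^] p = \<one>"
    proof -
      have "f [^] p = (e [^] p) [^] (- l)"
        using ec by (simp add: f_def int_pow_int[symmetric] int_pow_pow mult.commute)
      then show ?thesis using ep by simp
    qed
    \<comment> \<open>Oddness makes \<open>p\<close> divide p (p - 1) / 2, which kills the
      correction term of \<open>class_two_pow\<close>.\<close>
    have "odd p" using p prime_p prime_ge_2_nat[of p] primes_dvd_imp_eq[of 2 p] by auto
    then have "p * (p - 1) div 2 = p * ((p - 1) div 2)" by (auto elim!: oddE)
    then have "f [^] (p * (p - 1) div 2) = \<one>" using fc fp by (simp add: nat_pow_pow[symmetric])
    then have "(g \<otimes> u) [^] p = g [^] p \<otimes> u [^] p"
      using class_two_pow[OF c(2) uc(1) fc(1) ug fg fu, of p] c uc by simp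
    also have "u [^] p = inv (g [^] p)"
      using l c by (simp add: u_def int_pow_neg nat_pow_inv)
    finally have "(g \<otimes> u) [^] p = \<one>" using c by simp
    then have "g \<otimes> u \<in> generate G {x}" using order_p_in_cyclic[OF c(1) x1] c uc by simp
    then have "g \<in> generate G {x}"
      using subgroup_rcancel[OF X.subgroup_axioms uc(2) c(2)] by blast
    then show False using gx by contradiction
  qed
qed

section \<open>Subgroups of index p\<close>

text \<open>Two of the powers \<open>g^0\<close>, ..., \<open>g^p\<close> share a coset of
  \<open>M\<close>, so \<open>g^d \<in> M\<close> for some \<open>0 < d \<le> p\<close>. For
  \<open>d < p\<close> the power \<open>g^d\<close> would generate \<open>g\<close>.\<close>

lemma index_p_pow:
  assumes "subgroup M G" "subgroup H G" "M \<subseteq> H" "card H = p * card M" "g \<in> H" "g \<notin> M"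
  shows "g [^] p \<in> M"
proof -
  have gc: "g \<in> carrier G" using assms subgroup.mem_carrier by metis
  obtain i j where ij: "i < j" "j \<le> p" "inv (g [^] i) \<otimes> g [^] j \<in> M"
    using pigeonhole_cosets[OF finite_carrier assms(1-4), of "\<lambda>i. g [^] i"]
      subgroup_nat_pow_closed[OF assms(2,5)] by blast
  have "g [^] j = g [^] i \<otimes> g [^] (j - i)" using ij gc by (simp add: nat_pow_mult)
  then have d: "g [^] (j - i) \<in> M" using ij gc by (simp add: m_assoc[symmetric])
  have "j - i = p"
  proof (rule ccontr)
    assume "j - i \<noteq> p"
    then have nd: "\<not> int p dvd int (j - i)" using ij by (auto dest!: dvd_imp_le simp del: of_nat_diff)
    have "g \<in> generate G {g [^] (j - i)}"
      using coprime_power_generates[OF gc nd] by (simp only: int_pow_int)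
    moreover have "generate G {g [^] (j - i)} \<subseteq> M"
      using d assms(1) by (intro generate_subgroup_incl) auto
    ultimately show False using assms(6) by blast
  qed
  then show ?thesis using d by simp
qed

text \<open>A fixed point argument: \<open>x\<close> fixes the coset \<open>M\<close>, and its orbit on the remaining
  \<open>p - 1\<close> cosets of \<open>M\<close> is too short to be nontrivial.\<close>

lemma index_p_normal:
  assumes "subgroup M G" "subgroup H G" "M \<subseteq> H" "card H = p * card M" "g \<in> H" "g \<notin> M" "x \<in> M"
  shows "inv g \<otimes> x \<otimes> g \<in> M"
proof -
  have gc: "g \<in> carrier G" and xc: "x \<in> carrier G"
    using assms subgroup.mem_carrier by metis+
  \<comment> \<open>Besides \<open>\<one>\<close> these are \<open>x^0 g\<close>, ...,
    \<open>x^(p - 1) g\<close>. As \<open>g \<notin> M\<close>, two of the latter collide, so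
    \<open>x^d\<close> with \<open>0 < d < p\<close> fixes the coset \<open>g M\<close>, and such a
    power generates \<open>x\<close>.\<close>
  define a where "a = (\<lambda>i::nat. if i = 0 then \<one> else x [^] (i - 1) \<otimes> g)"
  have xM: "x [^] n \<in> M" for n :: nat using subgroup_nat_pow_closed assms by blast
  have "x [^] n \<otimes> g \<in> H" for n :: nat
    using xM[of n] assms(3,5) subgroup.m_closed[OF assms(2)] by blast
  then have "a i \<in> H" for i
    using subgroup.one_closed[OF assms(2)] by (simp add: a_def)
  then obtain i j where ij: "i < j" "j \<le> p" "inv (a i) \<otimes> a j \<in> M"
    using pigeonhole_cosets[OF finite_carrier assms(1-4), of a] by blast
  have "i \<noteq> 0"
  proof
    assume "i = 0"
    then have "x [^] (j - 1) \<otimes> g \<in> M" using ij gc xc by (simp add: a_def)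
    then show False using assms(6) subgroup_lcancel[OF assms(1) xM gc] by blast
  qed
  have "x [^] (j - 1) = x [^] (i - 1) \<otimes> x [^] (j - i)"
    using ij xc \<open>i \<noteq> 0\<close> by (simp add: nat_pow_mult)
  then have "inv (a i) \<otimes> a j = inv g \<otimes> x [^] (j - i) \<otimes> g"
    using ij gc xc \<open>i \<noteq> 0\<close> by (simp add: a_def inv_mult_group m_assoc) (simp add: m_assoc[symmetric])
  then have d: "inv g \<otimes> x [^] (j - i) \<otimes> g \<in> M" using ij by simp
  have nd: "\<not> int p dvd int (j - i)" using ij \<open>i \<noteq> 0\<close> by (auto dest!: dvd_imp_le simp del: of_nat_diff)
  have "x \<in> generate G {x [^] (j - i)}"
    using coprime_power_generates[OF xc nd] by (simp only: int_pow_int)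
  then obtain k :: int where "x = (x [^] (j - i)) [^] k" using xc in_cyclic_iff by blast
  then have "inv g \<otimes> x \<otimes> g = (inv g \<otimes> x [^] (j - i) \<otimes> g) [^] k"
    using conj_int_pow[OF gc, of "x [^] (j - i)" k] xc by simp
  then show ?thesis using d subgroup_int_pow_closed[OF assms(1)] by simp
qed

end

section \<open>Cyclic subgroups and subgroups of quaternion type\<close>

context group
begin

text \<open>An element of order at most two is its own inverse, so inverting it means commuting with
  it. In a 2-group this makes the order of \<open>x\<close> at least four.\<close>

lemma noncommuting_inverted_ord:
  assumes "y \<in> carrier G" "x \<in> carrier G" "inv y \<otimes> x \<otimes> y = inv x" "y \<otimes> x \<noteq> x \<otimes> y"
  shows "\<not> ord x dvd 2"
proof
  assume "ord x dvd 2"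
  then have "x \<otimes> x = \<one>" using assms pow_eq_id[of x 2] by (simp add: pow_two)
  then have "inv x = x" using assms inv_equality by blast
  then show False using assms commute_iff_conj by simp
qed

lemma inverted_coset_squares:
  assumes c: "x \<in> carrier G" "y \<in> carrier G" and inv: "inv y \<otimes> x \<otimes> y = inv x"
    and v: "v \<in> generate G {x}"
  shows "(y \<otimes> v) \<otimes> (y \<otimes> v) = y \<otimes> y"
proof -
  have vc: "v \<in> carrier G" using v c cyclic_closed by blast
  have "(y \<otimes> v) \<otimes> (y \<otimes> v) = y \<otimes> y \<otimes> (inv y \<otimes> v \<otimes> y) \<otimes> v"
    using c vc by (simp add: m_assoc) (simp add: m_assoc[symmetric])
  also have "\<dots> = y \<otimes> y" using inverted_cyclic[OF c(2,1) inv v] c vc by (simp add: m_assoc)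
  finally show ?thesis .
qed

end

context unique_order_p_group
begin

text \<open>An internal form of the generalized quaternion relations, with \<open>z\<close> in place
  of the involution of \<langle>x\<rangle>. Noncommutation excludes the cyclic group of order four,
  with \<open>x = z\<close> and \<open>y\<close> a generator.\<close>

definition quaternion_type :: "'a set \<Rightarrow> bool" where
  "quaternion_type H \<longleftrightarrow> p = 2 \<and> (\<exists>x\<in>H. \<exists>y\<in>H. y \<notin> generate G {x} \<and> y \<otimes> y = z \<and>
     inv y \<otimes> x \<otimes> y = inv x \<and> y \<otimes> x \<noteq> x \<otimes> y \<and> card H = 2 * ord x)"

lemma card_cyclic: "x \<in> carrier G \<Longrightarrow> card (generate G {x}) = ord x"
  using generate_pow_card by simp

lemma cyclic_subset:
  "subgroup H G \<Longrightarrow> x \<in> H \<Longrightarrow> generate G {x} \<subseteq> H"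
  by (intro generate_subgroup_incl) auto

lemma finite_subgroup: "subgroup H G \<Longrightarrow> finite H"
  using finite_carrier finite_subset subgroup.subset by blast

lemma eq_cyclicI:
  assumes "subgroup H G" "x \<in> H" "card H \<le> ord x"
  shows "H = generate G {x}"
  using card_seteq[OF finite_subgroup[OF assms(1)] cyclic_subset[OF assms(1,2)]]
    assms card_cyclic subgroup.mem_carrier by metis

lemma ord_jump:
  assumes "x \<in> carrier G" "g \<in> carrier G" "x \<in> generate G {g}" "g \<notin> generate G {x}"
  shows "p * ord x dvd ord g"
proof -
  obtain a b where ab: "ord x = p ^ a" "ord g = p ^ b" using ord_prime_power assms by metis
  have "\<not> ord g \<le> ord x"
    using eq_cyclicI[OF cyclic_subgroup[OF assms(2)] assms(3)] assms card_cyclic cyclic_self by metis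
  then have "p ^ a < p ^ b" using ab by simp
  then have "a < b" using prime_gt_1_nat[OF prime_p] by (simp add: power_strict_increasing_iff)
  then have "p ^ Suc a dvd p ^ b" by (intro le_imp_power_dvd) simp
  then show ?thesis using ab by simp
qed

text \<open>Any \<open>g\<close> in \<open>H\<close> outside \<langle>x\<rangle> normalizes it and
  has its \<open>p\<close>-th power in it. If \<open>g\<close> commutes with \<open>x\<close>,
  comparability makes \<open>g\<close> a generator of \<open>H\<close>; otherwise
  \<open>p = 2\<close>, and the squares of \<open>g\<close> and \<open>g x\<close> show that
  \<open>g\<close> inverts \<open>x\<close>.\<close>

lemma cyclic_index_p:
  assumes H: "subgroup H G" and x: "x \<in> H" and card: "card H = p * ord x"
  shows "(\<exists>u\<in>H. H = generate G {u}) \<or> quaternion_type H"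
proof -
  have xc: "x \<in> carrier G" using H x subgroup.mem_carrier by metis
  note M = cyclic_subgroup[OF xc] H cyclic_subset[OF H x]
  have card': "card H = p * card (generate G {x})" using card card_cyclic xc by simp
  have "ord x < card H"
    using card prime_gt_1_nat[OF prime_p] ord_nonzero[OF xc] by simp
  then have "generate G {x} \<noteq> H" using card_cyclic xc by fastforce
  then obtain g where g: "g \<in> H" "g \<notin> generate G {x}" using M(3) by blast
  have gc: "g \<in> carrier G" using H g subgroup.mem_carrier by metis
  have gp: "g [^] p \<in> generate G {x}" using index_p_pow[OF M card' g] .
  have gx: "inv g \<otimes> x \<otimes> g \<in> generate G {x}" using index_p_normal[OF M card' g cyclic_self] .
  show ?thesis
  proof (cases "g \<otimes> x = x \<otimes> g")
    case True
    then have "x \<in> generate G {g}" using commuting_cyclic_comparable xc gc g by blast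
    then have "p * ord x dvd ord g" using ord_jump xc gc g by blast
    then have "card H \<le> ord g" using card ord_nonzero[OF gc] by (simp add: dvd_imp_le)
    then show ?thesis using eq_cyclicI[OF H] g by blast
  next
    case False
    then have p: "p = 2" using odd_normalizer_commutes[OF _ xc gc gx gp] by blast
    have "g \<otimes> x \<in> H" using H g x subgroup.m_closed by metis
    moreover have "g \<otimes> x \<notin> generate G {x}"
      using subgroup_rcancel[OF M(1) cyclic_self gc] g by blast
    ultimately have "(g \<otimes> x) [^] p \<in> generate G {x}" using index_p_pow[OF M card'] by blast
    then have "g \<otimes> g = z" "inv g \<otimes> x \<otimes> g = inv x"
      using noncommuting_inverts[OF p xc gc g(2) _ _ False] gp p gc xc by (auto simp: pow_two)
    then show ?thesis unfolding quaternion_type_def using p g x card False by blast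
  qed
qed

text \<open>In the generalized quaternion group of order \<open>2\<^sup>n\<close> with \<open>n > 3\<close> the cyclic subgroup of
  index two is unique, hence normalized by \<open>H\<close>; if \<open>M\<close> has order \<open>8\<close>, then either \<open>H\<close> has an
  element of order \<open>8\<close>, or \<open>H\<close> modulo \<open>z\<close> has exponent two and is abelian.\<close>

lemma quaternion_index_two:
  assumes M: "subgroup M G" and H: "subgroup H G" and MH: "M \<subseteq> H" and card: "card H = 2 * card M"
    and Q: "quaternion_type M"
  shows "\<exists>u\<in>H. card M dvd ord u"
proof (rule ccontr)
  assume no: "\<not> ?thesis"
  obtain x y where p: "p = 2" and xM: "x \<in> M" and yM: "y \<in> M" and yx: "y \<notin> generate G {x}"
    and yy: "y \<otimes> y = z" and inv: "inv y \<otimes> x \<otimes> y = inv x" and nc: "y \<otimes> x \<noteq> x \<otimes> y"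
    and cM: "card M = 2 * ord x" using Q unfolding quaternion_type_def by blast
  have cardp: "card H = p * card M" using p card by simp
  note sub = M H MH cardp
  have xc: "x \<in> carrier G" and yc: "y \<in> carrier G" using M xM yM subgroup.mem_carrier by metis+
  interpret X: subgroup "generate G {x}" G using xc by (rule cyclic_subgroup)
  interpret M: subgroup M G by fact
  interpret H: subgroup H G by fact
  have xnc: "x \<noteq> \<one>" using nc yc by auto
  have "card M \<noteq> 0" using cM ord_nonzero xc by simp
  then have "M \<noteq> H" using card by auto
  then obtain g where g: "g \<in> H" "g \<notin> M" using MH by blast
  have gc: "g \<in> carrier G" using g by auto
  have XM: "generate G {x} \<subseteq> M" using cyclic_subset M xM by blast
  \<comment> \<open>Comparability would make \<open>x\<close> a power of \<open>c\<close>, so that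
    \<open>2 * ord x = card M\<close> would divide \<open>ord c\<close>.\<close>
  have no_commute: "c \<otimes> x \<noteq> x \<otimes> c" if c: "c \<in> H" "c \<notin> M" for c
  proof
    assume "c \<otimes> x = x \<otimes> c"
    moreover have "c \<notin> generate G {x}" using c XM by blast
    ultimately have "2 * ord x dvd ord c"
      using commuting_cyclic_comparable[of x c] ord_jump[of x c] xc c p by auto
    then show False using no c cM by metis
  qed
  have "\<not> ord x dvd 2" using noncommuting_inverted_ord[OF yc xc inv nc] .
  moreover obtain k where k: "ord x = 2 ^ k" using ord_prime_power xc p by blast
  ultimately have "2 \<le> k" using le_imp_power_dvd[of k 1 "2::nat"] by (cases "k \<le> 1") auto
  then have four: "4 dvd ord x" using le_imp_power_dvd[of 2 k "2::nat"] k by simp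
  define t where "t = inv g \<otimes> x \<otimes> g"
  have tM: "t \<in> M" using index_p_normal[OF sub g xM] t_def by simp
  have tx: "t \<in> generate G {x}"
  proof (rule ccontr)
    assume t: "t \<notin> generate G {x}"
    have "inv y \<otimes> t \<in> generate G {x}"
      using index_two_coset[OF finite_carrier X.subgroup_axioms M XM _ yM yx tM t] cM card_cyclic xc by simp
    \<comment> \<open>All elements of the coset \<open>y \<langle>x\<rangle>\<close> square to
      \<open>z\<close>, so \<open>t^2 = z\<close>; conjugating back gives \<open>x^2 = z\<close>,
      and \<open>M\<close> has order eight.\<close>
    then have "(y \<otimes> (inv y \<otimes> t)) \<otimes> (y \<otimes> (inv y \<otimes> t)) = z"
      using inverted_coset_squares[OF xc yc inv] yy by simp
    then have "t \<otimes> t = z" using yc tM by (simp add: m_assoc[symmetric])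
    then have "inv g \<otimes> (x \<otimes> x) \<otimes> g = z"
      using conj_nat_pow[OF gc xc, of 2] xc gc by (simp add: pow_two t_def)
    moreover have "x \<otimes> x \<otimes> g = g \<otimes> (inv g \<otimes> (x \<otimes> x) \<otimes> g)"
      using gc xc by (simp add: m_assoc[symmetric])
    ultimately have "x \<otimes> x \<otimes> g = z \<otimes> g" using z_central[OF gc] by metis
    then have xz: "x \<otimes> x = z" using r_cancel[OF _ _ _ gc] xc z_closed by blast
    have "x [^] (4::nat) = (x [^] (2::nat)) [^] (2::nat)" using xc by (simp add: nat_pow_pow)
    then have "x [^] (4::nat) = \<one>" using xz z_pow_p p xc by (simp add: pow_two)
    then have "ord x dvd 4" using xc pow_eq_id by blast
    then have cM8: "card M = 8" using four cM by (simp add: dvd_antisym)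
    \<comment> \<open>Elements of \<open>H\<close> have 2-power order not divisible by eight, so all
      squares are killed by 2.\<close>
    have sq: "h \<otimes> h \<in> generate G {x}" if h: "h \<in> H" for h
    proof -
      obtain i where i: "ord h = 2 ^ i" using ord_prime_power[of h] h p by auto
      have "\<not> 3 \<le> i" using no h cM8 i le_imp_power_dvd[of 3 i "2::nat"] by auto
      then have "ord h dvd 4" using i le_imp_power_dvd[of i 2 "2::nat"] by auto
      then have "h [^] (4::nat) = \<one>" using h pow_eq_id by simp
      moreover have "(h [^] (2::nat)) [^] (2::nat) = h [^] (4::nat)" using h by (simp add: nat_pow_pow)
      ultimately have "(h \<otimes> h) [^] p = \<one>" using h p by (simp add: pow_two)
      then show ?thesis using order_p_in_cyclic[OF xc xnc] h by simp
    qed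
    \<comment> \<open>A product of two squares that equals \<open>t x\<close>, which puts
      \<open>t\<close> into \<langle>x\<rangle>.\<close>
    have "(inv g \<otimes> inv g) \<otimes> ((g \<otimes> x) \<otimes> (g \<otimes> x)) \<in> generate G {x}"
      using sq[of "inv g"] sq[of "g \<otimes> x"] g xM MH by auto
    also have "(inv g \<otimes> inv g) \<otimes> ((g \<otimes> x) \<otimes> (g \<otimes> x)) = t \<otimes> x"
      using gc xc by (simp add: t_def m_assoc) (simp add: m_assoc[symmetric])
    finally have "t \<in> generate G {x}"
      using subgroup_rcancel[OF X.subgroup_axioms cyclic_self M.mem_carrier[OF tM]] by simp
    then show False using t by contradiction
  qed
  then obtain r :: int where r: "t = x [^] r" using in_cyclic_iff xc by blast
  have ggM: "g \<otimes> g \<in> M" using index_p_pow[OF sub g] p gc by (simp add: pow_two)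
  \<comment> \<open>If \<open>g^2\<close> lay in \<open>y \<langle>x\<rangle>\<close>, conjugation
    by it would invert \<open>x\<close>, making \<open>r^2\<close> congruent to -1 modulo
    \<open>ord x\<close>; but -1 is not a square modulo 4.\<close>
  have gg: "g \<otimes> g \<in> generate G {x}"
  proof (rule ccontr)
    assume n: "g \<otimes> g \<notin> generate G {x}"
    define v where "v = inv y \<otimes> (g \<otimes> g)"
    have v: "v \<in> generate G {x}"
      using index_two_coset[OF finite_carrier X.subgroup_axioms M XM _ yM yx ggM n] cM card_cyclic xc
      by (simp add: v_def)
    have vc: "v \<in> carrier G" using v by auto
    have "g \<otimes> g = y \<otimes> v" using gc yc by (simp add: v_def m_assoc[symmetric])
    then have "inv (g \<otimes> g) \<otimes> x \<otimes> (g \<otimes> g) = inv v \<otimes> inv x \<otimes> v"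
      using conj_mult[OF yc vc xc] inv by simp
    also have "\<dots> = inv x"
      using conj_commute[OF vc, of "inv x"] cyclic_commute[OF xc v, of "inv x"] xc cyclic_self by simp
    finally have 1: "inv (g \<otimes> g) \<otimes> x \<otimes> (g \<otimes> g) = x [^] (- 1 :: int)"
      using xc by (simp add: int_pow_neg)
    have "inv (g \<otimes> g) \<otimes> x \<otimes> (g \<otimes> g) = x [^] (r * r)"
      using conj_mult[OF gc gc xc] conj_int_pow[OF gc xc, of r] r xc
      by (simp add: t_def[symmetric] int_pow_pow)
    then have "int (ord x) dvd r * r + 1"
      using 1 int_pow_eq[OF xc, of "- 1" "r * r"] by simp
    then have "4 dvd r * r + 1" using four by (metis dvd_trans int_dvd_int_iff of_nat_numeral)
    moreover obtain b where "r = 2 * b \<or> r = 2 * b + 1" by (meson evenE oddE)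
    then have "r * r = 4 * (b * b) \<or> r * r = 4 * (b * b + b) + 1" by (auto simp: algebra_simps)
    ultimately show False by presburger
  qed
  have "(g \<otimes> x) \<otimes> (g \<otimes> x) = (g \<otimes> g) \<otimes> t \<otimes> x"
    using gc xc by (simp add: t_def m_assoc) (simp add: m_assoc[symmetric])
  then have "(g \<otimes> x) \<otimes> (g \<otimes> x) \<in> generate G {x}" using gg tx cyclic_self by simp
  moreover have "g \<notin> generate G {x}" using g XM by blast
  ultimately have ginv: "inv g \<otimes> x \<otimes> g = inv x"
    using noncommuting_inverts(2)[OF p xc gc _ gg] no_commute g by blast
  \<comment> \<open>Both \<open>y\<close> and \<open>g\<close> invert \<open>x\<close>, so
    \<open>y g\<close> commutes with \<open>x\<close> although it lies outside
    \<open>M\<close>.\<close>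
  have "inv g \<otimes> inv x \<otimes> g = inv (inv x)"
    using inverted_cyclic[OF gc xc ginv, of "inv x"] cyclic_self by simp
  then have "inv (y \<otimes> g) \<otimes> x \<otimes> (y \<otimes> g) = x" using conj_mult[OF yc gc xc] inv xc by simp
  then have "(y \<otimes> g) \<otimes> x = x \<otimes> (y \<otimes> g)" using commute_iff_conj yc gc xc by simp
  moreover have "y \<otimes> g \<in> H" using yM g MH by blast
  moreover have "y \<otimes> g \<notin> M" using subgroup_lcancel[OF M yM gc] g by blast
  ultimately show False using no_commute by blast
qed

text \<open>Sylow provides a subgroup \<open>M\<close> of index \<open>p\<close>. By induction it is
  cyclic or of quaternion type, and either way \<open>H\<close> has a cyclic subgroup of index at
  most \<open>p\<close>, which determines its structure.\<close>

lemma cyclic_or_quaternion_type: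
  assumes "subgroup H G" "card H = p ^ j"
  shows "(\<exists>u\<in>H. H = generate G {u}) \<or> quaternion_type H"
  using assms
proof (induction j arbitrary: H)
  case 0
  then have "card H \<le> ord \<one>" by simp
  then show ?case using eq_cyclicI[OF 0(1)] subgroup.one_closed[OF 0(1)] by blast
next
  case (Suc j)
  note H = Suc.prems(1)
  have "\<exists>M. subgroup M (G\<lparr>carrier := H\<rparr>) \<and> card M = p ^ j"
    using Suc.prems finite_subgroup[OF H]
    by (intro sylow_thm[OF prime_p subgroup_imp_group[OF H], of j p]) (auto simp: order_def)
  then obtain M where M': "subgroup M (G\<lparr>carrier := H\<rparr>)" and card: "card M = p ^ j" by blast
  have M: "subgroup M G" using incl_subgroup[OF H M'] .
  have MH: "M \<subseteq> H" using subgroup.subset[OF M'] by simp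
  have "\<exists>u\<in>H. p ^ j dvd ord u"
    using Suc.IH[OF M card]
  proof
    assume "\<exists>u\<in>M. M = generate G {u}"
    then obtain u where "u \<in> M" "M = generate G {u}" by blast
    then have "u \<in> H" "ord u = p ^ j"
      using card card_cyclic[of u] MH M subgroup.mem_carrier by fastforce+
    then show ?thesis by (metis dvd_refl)
  next
    assume Q: "quaternion_type M"
    then have "card H = 2 * card M" using card Suc.prems(2) by (simp add: quaternion_type_def)
    then show ?thesis using quaternion_index_two[OF M H MH _ Q] card by simp
  qed
  then obtain u where u: "u \<in> H" "p ^ j dvd ord u" by blast
  obtain i where i: "ord u = p ^ i" using ord_prime_power subgroup.mem_carrier[OF H u(1)] by blast
  have p1: "1 < p" using prime_gt_1_nat[OF prime_p] .
  have "j \<le> i" using u i p1 by (metis power_dvd_imp_le)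
  then consider "i = j" | "Suc j \<le> i" by linarith
  then show ?case
  proof cases
    case 1
    then show ?thesis using cyclic_index_p[OF H u(1)] Suc.prems(2) i by simp
  next
    case 2
    then have "card H \<le> ord u" using i p1 Suc.prems(2) by (simp only: power_increasing_iff)
    then show ?thesis using eq_cyclicI[OF H u(1)] u by blast
  qed
qed

end

section \<open>Presented groups and normal forms\<close>

text \<open>The states will be either the elements of a target group, for defining homomorphisms, or
  vectors, for telling words apart.\<close>

definition word_act :: "('g \<Rightarrow> bool \<Rightarrow> 's \<Rightarrow> 's) \<Rightarrow> 'g word \<Rightarrow> 's \<Rightarrow> 's" where
  "word_act f w = foldr (\<lambda>(g, s). f g s) w"

lemma word_act_simps [simp]:
  "word_act f [] a = a"
  "word_act f ((g, s) # w) a = f g s (word_act f w a)"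
  "word_act f (u @ v) a = word_act f u (word_act f v a)"
  by (simp_all add: word_act_def)

lemma word_act_replicate: "word_act f (replicate n (g, s)) a = (f g s ^^ n) a"
  by (induction n) simp_all

text \<open>Each rule of \<open>word_cong\<close> is respected: cancellation by
  \<open>inverse\<close>, the relations by \<open>rel\<close>, and \<open>append\<close> because
  \<open>S\<close> is stable under all letters.\<close>

lemma word_cong_act:
  assumes closed: "\<And>g s a. a \<in> S \<Longrightarrow> f g s a \<in> S"
    and inverse: "\<And>g s a. a \<in> S \<Longrightarrow> f g s (f g (\<not> s) a) = a"
    and rel: "\<And>u v a. (u, v) \<in> R \<Longrightarrow> a \<in> S \<Longrightarrow> word_act f u a = word_act f v a"
    and uv: "(u, v) \<in> word_cong R" and a: "a \<in> S"
  shows "word_act f u a = word_act f v a"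
proof -
  have S: "word_act f w a \<in> S" if "a \<in> S" for w a
    using that by (induction w) (auto simp: closed)
  show ?thesis using uv a
    by (induction arbitrary: a rule: word_cong.induct) (auto simp: S inverse rel)
qed

section \<open>Homomorphisms out of a presented group\<close>

context group
begin

definition letter_mult :: "('g \<Rightarrow> 'a) \<Rightarrow> 'g \<Rightarrow> bool \<Rightarrow> 'a \<Rightarrow> 'a" where
  "letter_mult \<phi> g s a = (if s then \<phi> g else inv (\<phi> g)) \<otimes> a"

lemma letter_mult_closed [simp]:
  "range \<phi> \<subseteq> carrier G \<Longrightarrow> a \<in> carrier G \<Longrightarrow> letter_mult \<phi> g s a \<in> carrier G"
  by (auto simp: letter_mult_def)

lemma word_act_closed [simp]:
  "range \<phi> \<subseteq> carrier G \<Longrightarrow> a \<in> carrier G \<Longrightarrow> word_act (letter_mult \<phi>) w a \<in> carrier G"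
  by (induction w) auto

text \<open>Right multiplication by \<open>a\<close> commutes with left multiplication by letters.
  Consequently the values of words at \<open>\<one>\<close> multiply under concatenation.\<close>

lemma word_act_one_mult:
  assumes "range \<phi> \<subseteq> carrier G" "a \<in> carrier G"
  shows "word_act (letter_mult \<phi>) w \<one> \<otimes> a = word_act (letter_mult \<phi>) w a"
proof (induction w)
  case (Cons l w)
  obtain g s where l: "l = (g, s)" by fastforce
  have "\<phi> g \<in> carrier G" using assms by blast
  then have "letter_mult \<phi> g s (word_act (letter_mult \<phi>) w \<one>) \<otimes> a =
      letter_mult \<phi> g s (word_act (letter_mult \<phi>) w \<one> \<otimes> a)"
    using assms by (simp add: letter_mult_def m_assoc)
  then show ?case using Cons l by simp
qed (use assms in simp)

text \<open>Von Dyck's theorem: words act on \<open>G\<close> by left multiplication, and by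
  \<open>word_cong_act\<close> the value at \<open>\<one>\<close> depends only on the congruence
  class.\<close>

lemma presented_group_hom:
  assumes \<phi>: "range \<phi> \<subseteq> carrier G"
    and rel: "\<And>u v. (u, v) \<in> R \<Longrightarrow> word_act (letter_mult \<phi>) u \<one> = word_act (letter_mult \<phi>) v \<one>"
  obtains h where "h \<in> hom (presented_group R) G"
    "\<And>w. h (word_cong R `` {w}) = word_act (letter_mult \<phi>) w \<one>"
proof
  let ?val = "\<lambda>w. word_act (letter_mult \<phi>) w \<one>"
  define h where "h = (\<lambda>A. ?val (SOME w. w \<in> A))"
  have \<phi>c: "\<phi> g \<in> carrier G" for g using \<phi> by blast
  have cong: "?val u = ?val v" if "(u, v) \<in> word_cong R" for u v
  proof (rule word_cong_act[where S = "carrier G", OF _ _ _ that])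
    show "letter_mult \<phi> g s (letter_mult \<phi> g (\<not> s) a) = a" if "a \<in> carrier G" for g s a
      using that \<phi>c[of g] by (auto simp: letter_mult_def m_assoc[symmetric])
    show "word_act (letter_mult \<phi>) u a = word_act (letter_mult \<phi>) v a"
      if "(u, v) \<in> R" "a \<in> carrier G" for u v a
      using rel[OF that(1)] word_act_one_mult[OF \<phi> that(2)] by metis
  qed (use \<phi> in auto)
  show h: "h (word_cong R `` {w}) = ?val w" for w
  proof -
    have "(SOME u. u \<in> word_cong R `` {w}) \<in> word_cong R `` {w}"
      by (rule someI[of _ w]) (simp add: word_cong.refl)
    then show ?thesis using cong by (fastforce simp: h_def)
  qed
  show "h \<in> hom (presented_group R) G"
    using \<phi> by (auto simp: hom_def presented_group_carrier presented_group_mult h word_act_one_mult)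
qed

text \<open>Here \<open>inv y \<otimes> h \<in> generate G {x}\<close> encodes
  \<open>h \<in> y \<langle>x\<rangle>\<close>. Powers of \<open>x\<close> preserve both pieces
  since \<open>y\<close> normalizes \<langle>x\<rangle>; \<open>y\<close> and its inverse exchange
  them since \<open>y^2\<close> is a power of \<open>x\<close>.\<close>

lemma cyclic_union_coset_mult_closed:
  assumes c: "x \<in> carrier G" "y \<in> carrier G" "h \<in> carrier G"
    and yy: "y \<otimes> y \<in> generate G {x}" and inv: "inv y \<otimes> x \<otimes> y = inv x"
    and h: "h \<in> generate G {x} \<or> inv y \<otimes> h \<in> generate G {x}"
    and a: "a \<in> {x, inv x, y, inv y}"
  shows "a \<otimes> h \<in> generate G {x} \<or> inv y \<otimes> (a \<otimes> h) \<in> generate G {x}"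
proof -
  interpret X: subgroup "generate G {x}" G using c by (intro cyclic_subgroup)
  consider "a \<in> generate G {x}" | "a = y" | "a = inv y" using a cyclic_self by blast
  then show ?thesis
  proof cases
    case 1
    have ac: "a \<in> carrier G" using 1 by simp
    have "inv y \<otimes> (a \<otimes> h) = (inv y \<otimes> a \<otimes> y) \<otimes> (inv y \<otimes> h)"
      using c ac by (simp add: m_assoc) (simp add: m_assoc[symmetric])
    then show ?thesis using h 1 inverted_cyclic[OF c(2,1) inv 1] by auto
  next
    case 2
    have "y \<otimes> h = (y \<otimes> y) \<otimes> (inv y \<otimes> h)"
      using c by (simp add: m_assoc) (simp add: m_assoc[symmetric])
    moreover have "inv y \<otimes> (y \<otimes> h) = h" using c by (simp add: m_assoc[symmetric])
    ultimately show ?thesis using h 2 yy by auto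
  next
    case 3
    have "inv y \<otimes> (inv y \<otimes> h) = inv (y \<otimes> y) \<otimes> h"
      using c by (simp add: inv_mult_group m_assoc)
    then show ?thesis using h 3 yy by auto
  qed
qed

end

text \<open>The action of \<open>x\<close> and \<open>y\<close> on pairs of complex numbers through the two-dimensional
  representation of the generalized quaternion group.\<close>

fun quaternion_act :: "complex \<Rightarrow> gen \<Rightarrow> bool \<Rightarrow> complex \<times> complex \<Rightarrow> complex \<times> complex" where
  "quaternion_act \<omega> GX s (a, b) = (if s then (\<omega> * a, cnj \<omega> * b) else (cnj \<omega> * a, \<omega> * b))"
| "quaternion_act \<omega> GY s (a, b) = (if s then (- b, a) else (b, - a))"

lemma quaternion_act_power:
  "(quaternion_act \<omega> GX True ^^ m) (a, b) = (\<omega> ^ m * a, cnj \<omega> ^ m * b)"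
  by (induction m) (auto simp: mult.assoc)

definition quaternion_rels :: "nat \<Rightarrow> (gen word \<times> gen word) set" where
  "quaternion_rels n =
     {(replicate (2 ^ (n - 1)) (GX, True), []),
      ([(GY, True), (GY, True)], replicate (2 ^ (n - 2)) (GX, True)),
      ([(GY, False), (GX, True), (GY, True)], [(GX, False)])}"

lemma gen_quaternion_rels: "gen_quaternion n = presented_group (quaternion_rels n)"
  by (simp add: gen_quaternion_def quaternion_rels_def)

text \<open>The relations by themselves only bound the group from above; that this word does not
  collapse is seen in a representation where it acts as -1.\<close>

lemma central_word_nontrivial:
  assumes "2 \<le> n"
  shows "(replicate (2 ^ (n - 2)) (GX, True), []) \<notin> word_cong (quaternion_rels n)"
proof
  assume *: "(replicate (2 ^ (n - 2)) (GX, True), []) \<in> word_cong (quaternion_rels n)"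
  \<comment> \<open>A primitive \<open>2^(n - 1)\<close>-th root of unity.\<close>
  define \<omega> where "\<omega> = cis (pi / 2 ^ (n - 2))"
  have half: "\<omega> ^ (2 ^ (n - 2)) = - 1" by (simp add: \<omega>_def DeMoivre)
  have chalf: "cnj \<omega> ^ (2 ^ (n - 2)) = - 1" using arg_cong[OF half, of cnj] by (simp only: complex_cnj_power complex_cnj_minus complex_cnj_one)
  have "n - 1 = Suc (n - 2)" using assms by simp
  then have n: "(2::nat) ^ (n - 1) = 2 ^ (n - 2) * 2" by simp
  have full: "\<omega> ^ (2 ^ (n - 1)) = 1" "cnj \<omega> ^ (2 ^ (n - 1)) = 1"
    by (simp_all only: n power_mult half chalf) simp_all
  have "\<omega> * cnj \<omega> = 1" "cnj \<omega> * \<omega> = 1" by (simp_all add: \<omega>_def cis_cnj cis_mult)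
  then have cnj: "\<omega> * (cnj \<omega> * a) = a" "cnj \<omega> * (\<omega> * a) = a" for a
    by (simp_all add: mult.assoc[symmetric])
  have "word_act (quaternion_act \<omega>) (replicate (2 ^ (n - 2)) (GX, True)) (1, 1) =
      word_act (quaternion_act \<omega>) [] (1, 1)"
  proof (rule word_cong_act[where S = UNIV, OF _ _ _ *])
    show "quaternion_act \<omega> g s (quaternion_act \<omega> g (\<not> s) a) = a" for g s a
      by (cases g; cases a) (simp_all add: cnj)
    show "word_act (quaternion_act \<omega>) u a = word_act (quaternion_act \<omega>) v a"
      if "(u, v) \<in> quaternion_rels n" for u v a
      using that half chalf full
      by (cases a) (auto simp: quaternion_rels_def word_act_replicate quaternion_act_power)
  qed auto
  then show False using half by (simp add: word_act_replicate quaternion_act_power)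
qed

lemma presented_group_letter_inv:
  "inv\<^bsub>presented_group R\<^esub> (word_cong R `` {[(g, True)]}) = word_cong R `` {[(g, False)]}"
proof -
  interpret P: group "presented_group R" by (rule group_presented_group)
  show ?thesis
  proof (rule P.inv_equality)
    show "word_cong R `` {[(g, False)]} \<otimes>\<^bsub>presented_group R\<^esub> word_cong R `` {[(g, True)]}
        = \<one>\<^bsub>presented_group R\<^esub>"
      using word_cong.cancel[of g False R]
      by (auto simp: presented_group_mult presented_group_one intro!: equiv_class_eq[OF equiv_word_cong])
  qed (auto simp: presented_group_carrier)
qed

lemma presented_group_replicate:
  "word_cong R `` {replicate m l} = (word_cong R `` {[l]}) [^]\<^bsub>presented_group R\<^esub> m"
proof -
  interpret P: group "presented_group R" by (rule group_presented_group)
  show ?thesis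
  proof (induction m)
    case 0
    show ?case by (simp add: presented_group_one)
  next
    case (Suc m)
    have "word_cong R `` {replicate (Suc m) l} =
        word_cong R `` {replicate m l} \<otimes>\<^bsub>presented_group R\<^esub> word_cong R `` {[l]}"
      by (simp add: presented_group_mult replicate_append_same)
    then show ?case using Suc by simp
  qed
qed

section \<open>Structure of the generalized quaternion group\<close>

locale gen_quaternion_group =
  fixes n :: nat
  assumes n_ge: "3 \<le> n"
begin

abbreviation Q :: "gen word set monoid" where "Q \<equiv> gen_quaternion n"
abbreviation R :: "(gen word \<times> gen word) set" where "R \<equiv> quaternion_rels n"

definition qx :: "gen word set" where "qx = word_cong (quaternion_rels n) `` {[(GX, True)]}"
definition qy :: "gen word set" where "qy = word_cong (quaternion_rels n) `` {[(GY, True)]}"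

sublocale group Q
  unfolding gen_quaternion_rels by (rule group_presented_group)

lemma gen_closed [simp]: "qx \<in> carrier Q" "qy \<in> carrier Q"
  by (simp_all add: qx_def qy_def gen_quaternion_rels presented_group_carrier)

lemma rel_eq: "(u, v) \<in> R \<Longrightarrow> word_cong R `` {u} = word_cong R `` {v}"
  by (intro equiv_class_eq[OF equiv_word_cong] word_cong.relation)

lemma qx_power: "qx [^]\<^bsub>Q\<^esub> (2 ^ (n - 1) :: nat) = \<one>\<^bsub>Q\<^esub>"
  using rel_eq[of "replicate (2 ^ (n - 1)) (GX, True)" "[]"]
  by (simp add: quaternion_rels_def[of n] presented_group_replicate qx_def gen_quaternion_rels presented_group_one)

lemma qy_square: "qy \<otimes>\<^bsub>Q\<^esub> qy = qx [^]\<^bsub>Q\<^esub> (2 ^ (n - 2) :: nat)"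
proof -
  have "word_cong R `` {[(GY, True), (GY, True)]} = word_cong R `` {replicate (2 ^ (n - 2)) (GX, True)}"
    by (rule rel_eq) (simp add: quaternion_rels_def)
  then show ?thesis
    by (simp add: presented_group_replicate presented_group_mult qx_def qy_def gen_quaternion_rels)
qed

lemma qy_inverts: "inv\<^bsub>Q\<^esub> qy \<otimes>\<^bsub>Q\<^esub> qx \<otimes>\<^bsub>Q\<^esub> qy = inv\<^bsub>Q\<^esub> qx"
proof -
  have "word_cong R `` {[(GY, False), (GX, True), (GY, True)]} = word_cong R `` {[(GX, False)]}"
    by (rule rel_eq) (simp add: quaternion_rels_def)
  then show ?thesis
    by (simp add: presented_group_letter_inv presented_group_mult qx_def qy_def gen_quaternion_rels)
qed

lemma center_nontrivial: "qx [^]\<^bsub>Q\<^esub> (2 ^ (n - 2) :: nat) \<noteq> \<one>\<^bsub>Q\<^esub>"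
proof
  assume "qx [^]\<^bsub>Q\<^esub> (2 ^ (n - 2) :: nat) = \<one>\<^bsub>Q\<^esub>"
  then have "word_cong R `` {replicate (2 ^ (n - 2)) (GX, True)} = word_cong R `` {[]}"
    by (simp add: presented_group_replicate qx_def gen_quaternion_rels presented_group_one)
  then have "(replicate (2 ^ (n - 2)) (GX, True), []) \<in> word_cong R"
    by (rule eq_equiv_class[OF _ equiv_word_cong]) simp
  then show False using central_word_nontrivial[of n] n_ge by simp
qed

lemma normal_form:
  assumes "h \<in> carrier Q"
  shows "h \<in> generate Q {qx} \<or> inv\<^bsub>Q\<^esub> qy \<otimes>\<^bsub>Q\<^esub> h \<in> generate Q {qx}"
proof -
  obtain w where w: "h = word_cong R `` {w}"
    using assms by (auto simp: gen_quaternion_rels presented_group_carrier)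
  have YY: "qy \<otimes>\<^bsub>Q\<^esub> qy \<in> generate Q {qx}" using qy_square cyclic_pow_mem by simp
  show ?thesis unfolding w
  proof (induction w)
    case Nil
    show ?case
      using generate.one[of Q "{qx}"] by (simp add: gen_quaternion_rels presented_group_one)
  next
    case (Cons l w)
    let ?a = "word_cong R `` {[l]}" and ?h = "word_cong R `` {w}"
    have eq: "word_cong R `` {l # w} = ?a \<otimes>\<^bsub>Q\<^esub> ?h"
      by (simp add: gen_quaternion_rels presented_group_mult)
    obtain g s where l: "l = (g, s)" by fastforce
    have "?a \<in> {qx, inv\<^bsub>Q\<^esub> qx, qy, inv\<^bsub>Q\<^esub> qy}"
      by (cases g; cases s)
        (simp_all add: l qx_def qy_def gen_quaternion_rels presented_group_letter_inv)
    moreover have "?h \<in> carrier Q" by (simp add: gen_quaternion_rels presented_group_carrier)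
    ultimately show ?case
      unfolding eq using cyclic_union_coset_mult_closed[OF gen_closed _ YY qy_inverts Cons] by blast
  qed
qed

text \<open>The normal form covers the group by \<langle>qx\<rangle> and one coset. The upper bound
  is what turns a surjection onto a group of order \<open>2^n\<close> into an isomorphism.\<close>

lemma card_le: "finite (carrier Q)" "card (carrier Q) \<le> 2 ^ n"
proof -
  let ?C = "generate Q {qx}"
  have dvd: "ord qx dvd 2 ^ (n - 1)" using qx_power pow_eq_id[of qx] by simp
  have ord: "ord qx \<noteq> 0" using dvd by (intro notI) simp
  have card: "card ?C = ord qx" using generate_pow_card[of qx] by simp
  then have fin: "finite ?C" using ord card.infinite by fastforce
  have sub: "carrier Q \<subseteq> ?C \<union> (\<lambda>v. qy \<otimes>\<^bsub>Q\<^esub> v) ` ?C"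
  proof
    fix h assume h: "h \<in> carrier Q"
    have "h = qy \<otimes>\<^bsub>Q\<^esub> (inv\<^bsub>Q\<^esub> qy \<otimes>\<^bsub>Q\<^esub> h)" using h by (simp add: m_assoc[symmetric])
    then show "h \<in> ?C \<union> (\<lambda>v. qy \<otimes>\<^bsub>Q\<^esub> v) ` ?C" using normal_form[OF h] by blast
  qed
  then show "finite (carrier Q)" using fin finite_subset by blast
  have "card (carrier Q) \<le> card ?C + card ((\<lambda>v. qy \<otimes>\<^bsub>Q\<^esub> v) ` ?C)"
    using card_mono[OF _ sub] card_Un_le[of ?C] fin by (meson finite_UnI finite_imageI le_trans)
  also have "\<dots> \<le> 2 * ord qx" using card_image_le[OF fin, of "\<lambda>v. qy \<otimes>\<^bsub>Q\<^esub> v"] card by simp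
  also have "\<dots> \<le> 2 * 2 ^ (n - 1)" using dvd by (simp add: dvd_imp_le)
  also have "\<dots> = 2 ^ n" using n_ge by (cases n) auto
  finally show "card (carrier Q) \<le> 2 ^ n" .
qed

text \<open>Outside \<langle>qx\<rangle> the square of \<open>h\<close> is \<open>qy^2\<close>, the
  central involution itself. Inside, the last nontrivial term of \<open>h\<close>,
  \<open>h^2\<close>, \<open>h^4\<close>, ... is an involution of the cyclic group
  \<langle>qx\<rangle>, which has only one.\<close>

lemma central_involution_in_cyclic:
  assumes h: "h \<in> carrier Q" "h \<noteq> \<one>\<^bsub>Q\<^esub>"
  shows "qx [^]\<^bsub>Q\<^esub> (2 ^ (n - 2) :: nat) \<in> generate Q {h}"
proof (cases "h \<in> generate Q {qx}")
  case False
  then have "inv\<^bsub>Q\<^esub> qy \<otimes>\<^bsub>Q\<^esub> h \<in> generate Q {qx}" using normal_form h by blast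
  from inverted_coset_squares[OF gen_closed qy_inverts this]
  have "h \<otimes>\<^bsub>Q\<^esub> h = qy \<otimes>\<^bsub>Q\<^esub> qy" using h by (simp add: m_assoc[symmetric])
  then show ?thesis using qy_square cyclic_pow_mem(2)[OF h(1), of 2] h pow_two by simp
next
  case True
  have n1: "n - 1 = Suc (n - 2)" using n_ge by simp
  obtain k :: int where k: "h = qx [^]\<^bsub>Q\<^esub> k" using True in_cyclic_iff by auto
  define i where "i = (LEAST i. h [^]\<^bsub>Q\<^esub> (2 ^ i :: nat) = \<one>\<^bsub>Q\<^esub>)"
  have "h [^]\<^bsub>Q\<^esub> (2 ^ (n - 1) :: nat) = (qx [^]\<^bsub>Q\<^esub> (2 ^ (n - 1) :: nat)) [^]\<^bsub>Q\<^esub> k"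
    unfolding k by (simp add: int_pow_int[symmetric] int_pow_pow mult.commute del: of_nat_power)
  then have "h [^]\<^bsub>Q\<^esub> (2 ^ (n - 1) :: nat) = \<one>\<^bsub>Q\<^esub>" using qx_power by simp
  then have i: "h [^]\<^bsub>Q\<^esub> (2 ^ i :: nat) = \<one>\<^bsub>Q\<^esub>" unfolding i_def by (rule LeastI)
  have "i \<noteq> 0" using i h by (intro notI) simp
  then obtain j where j: "i = Suc j" using not0_implies_Suc by blast
  define w where "w = h [^]\<^bsub>Q\<^esub> (2 ^ j :: nat)"
  have w1: "w \<noteq> \<one>\<^bsub>Q\<^esub>"
    using not_less_Least[of j "\<lambda>i. h [^]\<^bsub>Q\<^esub> (2 ^ i :: nat) = \<one>\<^bsub>Q\<^esub>"] j by (simp add: w_def i_def)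
  define m where "m = k * 2 ^ j"
  have wm: "w = qx [^]\<^bsub>Q\<^esub> m"
    unfolding w_def m_def k by (simp add: int_pow_int[symmetric] int_pow_pow)
  have "w [^]\<^bsub>Q\<^esub> (2::nat) = \<one>\<^bsub>Q\<^esub>" using i h by (simp add: w_def j nat_pow_pow mult.commute)
  then have "qx [^]\<^bsub>Q\<^esub> (m * 2) = \<one>\<^bsub>Q\<^esub>" unfolding wm by (simp add: int_pow_int[symmetric] int_pow_pow)
  then have "int (ord qx) dvd m * 2" using int_pow_eq_id by simp
  \<comment> \<open>The first relation bounds the order, and nontriviality of the central element
    excludes all smaller powers of two.\<close>
  moreover have "ord qx = 2 ^ (n - 1)"
  proof -
    have "ord qx dvd 2 ^ (n - 1)" using qx_power pow_eq_id[of qx] by simp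
    then obtain e where e: "e \<le> n - 1" "ord qx = 2 ^ e"
      using divides_primepow_nat[of 2] by (metis two_is_prime_nat)
    have "\<not> 2 ^ e dvd (2::nat) ^ (n - 2)" using center_nontrivial pow_eq_id[of qx] e by simp
    then have "e = n - 1" using e n1 le_imp_power_dvd[of e "n - 2" "2::nat"] by fastforce
    then show ?thesis using e by simp
  qed
  ultimately have "(2::int) ^ (n - 2) dvd m" unfolding n1 by (auto simp: mult.commute)
  then obtain q where q: "m = 2 ^ (n - 2) * q" by blast
  define z where "z = qx [^]\<^bsub>Q\<^esub> (2 ^ (n - 2) :: nat)"
  have zc: "z \<in> carrier Q" by (simp add: z_def)
  have "z [^]\<^bsub>Q\<^esub> (2::nat) = \<one>\<^bsub>Q\<^esub>" using qx_power n1 by (simp add: z_def nat_pow_pow mult.commute)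
  then have zz: "z [^]\<^bsub>Q\<^esub> (2 * b) = \<one>\<^bsub>Q\<^esub>" for b :: int
    using zc int_pow_int[of Q z 2] by (simp add: int_pow_pow[symmetric])
  have wz: "w = z [^]\<^bsub>Q\<^esub> q" unfolding wm q z_def by (simp add: int_pow_int[symmetric] int_pow_pow)
  obtain b where "q = 2 * b \<or> q = 2 * b + 1" by (meson evenE oddE)
  moreover have "z [^]\<^bsub>Q\<^esub> (2 * b + 1) = z" using zz[of b] zc by (simp add: int_pow_mult)
  ultimately have "w = z" using wz w1 zz[of b] by metis
  then show ?thesis using cyclic_pow_mem(2)[OF h(1), of "2 ^ j"] by (simp add: w_def z_def)
qed

end

text \<open>A nontrivial \<open>a^m\<close> has \<open>m\<close> coprime to \<open>q\<close>, and
  Bezout inverts \<open>m\<close> modulo \<open>q\<close>. This serves where orders are not yet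
  known to be powers of one prime.\<close>

lemma (in group) prime_order_generates:
  fixes q :: nat
  assumes "a \<in> carrier G" "Factorial_Ring.prime q" "a [^] q = \<one>" "w \<in> generate G {a}" "w \<noteq> \<one>"
  shows "a \<in> generate G {w}"
proof -
  obtain m :: int where m: "w = a [^] m" using assms in_cyclic_iff by blast
  have aq: "a [^] (v * int q) = \<one>" for v
    using assms by (simp add: int_pow_int int_pow_pow[symmetric] mult.commute[of v])
  have "\<not> int q dvd m" using m assms(5) aq by (auto elim!: dvdE simp: mult.commute)
  then have "coprime m (int q)"
    using assms(2) prime_imp_coprime[of "int q" m] by (simp add: coprime_commute)
  then obtain u v where uv: "u * m + v * int q = 1" using bezout_int[of m "int q"] by auto
  have "a = a [^] (m * u + v * int q)" using uv assms by (simp add: mult.commute)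
  also have "\<dots> = w [^] u" using assms aq m by (simp add: int_pow_mult int_pow_pow)
  finally show ?thesis using cyclic_pow_mem(1)[of w u] m assms(1) by simp
qed

text \<open>Adjacency speaks of distinct vertices only, so \<open>a = b\<close> is treated
  apart.\<close>

lemma complete_common_element:
  assumes "group G" "complete_sgraph (generalized_power_graph G)"
    and a: "a \<in> carrier G" "a \<noteq> \<one>\<^bsub>G\<^esub>" and b: "b \<in> carrier G" "b \<noteq> \<one>\<^bsub>G\<^esub>"
  obtains w where "w \<in> generate G {a}" "w \<in> generate G {b}" "w \<noteq> \<one>\<^bsub>G\<^esub>"
proof (cases "a = b")
  case True
  then show ?thesis using that[of a] a by (simp add: generate.incl)
next
  case False
  then have "{a, b} \<in> snd (generalized_power_graph G)"
    using assms by (auto simp: complete_sgraph_def generalized_power_graph_def)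
  then have "generate G {a} \<inter> generate G {b} \<noteq> {\<one>\<^bsub>G\<^esub>}"
    by (auto simp: generalized_power_graph_def doubleton_eq_iff)
  moreover have "\<one>\<^bsub>G\<^esub> \<in> generate G {a} \<inter> generate G {b}" by (simp add: generate.one)
  ultimately show ?thesis using that by blast
qed

lemma complete_if_common_element:
  assumes "z \<noteq> \<one>\<^bsub>G\<^esub>"
    and "\<And>g. g \<in> carrier G \<Longrightarrow> g \<noteq> \<one>\<^bsub>G\<^esub> \<Longrightarrow> z \<in> generate G {g}"
  shows "complete_sgraph (generalized_power_graph G)"
  using assms by (fastforce simp: complete_sgraph_def generalized_power_graph_def)

section \<open>Complete generalized power graphs\<close>

lemma prime_power_if_unique_prime_divisor:
  fixes m p :: nat
  assumes "m \<noteq> 0" "Factorial_Ring.prime p"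
    and uniq: "\<And>q. Factorial_Ring.prime q \<Longrightarrow> q dvd m \<Longrightarrow> q = p"
  shows "\<exists>k. m = p ^ k"
proof -
  obtain k r where kr: "\<not> p dvd r" "m = r * p ^ k"
    using prime_power_canonical[OF assms(2), of m] assms(1) by (metis neq0_conv)
  have "r = 1"
  proof (rule ccontr)
    assume "r \<noteq> 1"
    then obtain q where "Factorial_Ring.prime q" "q dvd r" using prime_factor_nat by blast
    then show False using uniq[of q] kr by auto
  qed
  then show ?thesis using kr by auto
qed

text \<open>Take \<open>z\<close> of prime order \<open>p\<close> in \<langle>g\<rangle>. If a prime
  \<open>q\<close> divides any element order, some \<langle>a\<rangle> of order \<open>q\<close>
  meets \<langle>z\<rangle> nontrivially, hence contains \<open>z\<close>, so \<open>q = p\<close>.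
  In the same way every element killed by \<open>p\<close> lies in \<langle>z\<rangle>.\<close>

lemma complete_imp_unique_order_p:
  assumes G: "group G" and fin: "finite (carrier G)"
    and complete: "complete_sgraph (generalized_power_graph G)"
    and g: "g \<in> carrier G" "g \<noteq> \<one>\<^bsub>G\<^esub>"
  obtains p z where "unique_order_p_group G p z"
proof -
  interpret group G by fact
  have ord0: "ord a \<noteq> 0" if "a \<in> carrier G" for a
    using ord_ge_1[OF fin that] by simp
  \<comment> \<open>The witness is the power of \<open>h\<close> with exponent
    \<open>ord h div q\<close>.\<close>
  have root: "\<exists>a. a \<in> generate G {h} \<and> a \<noteq> \<one>\<^bsub>G\<^esub> \<and> a [^]\<^bsub>G\<^esub> q = \<one>\<^bsub>G\<^esub>"
    if h: "h \<in> carrier G" and q: "Factorial_Ring.prime q" "q dvd ord h" for h and q :: nat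
  proof -
    obtain m where m: "ord h = q * m" using q by blast
    have m0: "m \<noteq> 0" using m ord0[OF h] by auto
    have "\<not> ord h dvd m"
      using m m0 prime_gt_1_nat[OF q(1)] by (auto dest!: dvd_imp_le)
    then have "h [^]\<^bsub>G\<^esub> m \<noteq> \<one>\<^bsub>G\<^esub>" using pow_eq_id h by blast
    moreover have "(h [^]\<^bsub>G\<^esub> m) [^]\<^bsub>G\<^esub> q = \<one>\<^bsub>G\<^esub>"
      using m h by (simp add: nat_pow_pow pow_eq_id mult.commute)
    ultimately show ?thesis using cyclic_pow_mem(2)[OF h] by blast
  qed
  have "ord g \<noteq> 1" using ord_eq_1 g by blast
  then obtain p where p: "Factorial_Ring.prime p" "p dvd ord g" using prime_factor_nat by blast
  obtain z where z: "z \<in> generate G {g}" "z \<noteq> \<one>\<^bsub>G\<^esub>" "z [^]\<^bsub>G\<^esub> p = \<one>\<^bsub>G\<^esub>" using root[OF g(1) p] by blast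
  have zc: "z \<in> carrier G" using z g cyclic_closed by blast
  have dvd_ord: "q = p" if h: "h \<in> carrier G" and q: "Factorial_Ring.prime q" "q dvd ord h" for h q
  proof -
    obtain a where a: "a \<in> generate G {h}" "a \<noteq> \<one>\<^bsub>G\<^esub>" "a [^]\<^bsub>G\<^esub> q = \<one>\<^bsub>G\<^esub>" using root[OF h q] by blast
    have ac: "a \<in> carrier G" using a h cyclic_closed by blast
    obtain w where w: "w \<in> generate G {a}" "w \<in> generate G {z}" "w \<noteq> \<one>\<^bsub>G\<^esub>"
      using complete_common_element[OF G complete ac a(2) zc z(2)] by blast
    have "z \<in> generate G {a}"
      using prime_order_generates[OF zc p(1) z(3) w(2,3)] cyclic_mono[OF ac w(1)] by blast
    then obtain k :: int where "z = a [^]\<^bsub>G\<^esub> k" using in_cyclic_iff ac by blast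
    then have "z [^]\<^bsub>G\<^esub> q = (a [^]\<^bsub>G\<^esub> q) [^]\<^bsub>G\<^esub> k"
      using ac by (simp add: int_pow_int[symmetric] int_pow_pow mult.commute)
    then have "ord z dvd q" using a zc by (simp add: pow_eq_id)
    moreover have "ord z = p" using p(1) z zc ord_eq_1[OF zc] by (auto simp: prime_nat_iff pow_eq_id)
    ultimately show ?thesis using p(1) q(1) primes_dvd_imp_eq by blast
  qed
  have "unique_order_p_group G p z"
  proof
    show "\<exists>k. ord h = p ^ k" if "h \<in> carrier G" for h
      using prime_power_if_unique_prime_divisor[OF ord0[OF that] p(1)] dvd_ord[OF that] by blast
    show "h \<in> generate G {z}" if h: "h \<in> carrier G" "h [^]\<^bsub>G\<^esub> p = \<one>\<^bsub>G\<^esub>" for h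
    proof (cases "h = \<one>\<^bsub>G\<^esub>")
      case True
      then show ?thesis using generate.one by metis
    next
      case False
      obtain w where w: "w \<in> generate G {h}" "w \<in> generate G {z}" "w \<noteq> \<one>\<^bsub>G\<^esub>"
        using complete_common_element[OF G complete h(1) False zc z(2)] by blast
      then show ?thesis
        using prime_order_generates[OF h(1) p(1) h(2) w(1,3)] cyclic_mono[OF zc w(2)] by blast
    qed
  qed (use fin p z zc in auto)
  then show ?thesis using that by blast
qed

section \<open>The order of the group and its isomorphism type\<close>

context unique_order_p_group
begin

text \<open>Sylow with exponent one is Cauchy's theorem: a prime \<open>q\<close> dividing the group
  order has a subgroup of order \<open>q\<close>, whose nontrivial elements have order a power of
  \<open>p\<close>.\<close>

lemma card_carrier_prime_power: "\<exists>j. card (carrier G) = p ^ j"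
proof (rule prime_power_if_unique_prime_divisor[OF _ prime_p])
  show "card (carrier G) \<noteq> 0" using finite_carrier by auto
  fix q :: nat assume q: "Factorial_Ring.prime q" "q dvd card (carrier G)"
  then obtain m where "order G = q ^ 1 * m" by (auto simp: order_def)
  then obtain H where H: "subgroup H G" "card H = q"
    using sylow_thm[OF q(1) is_group _ finite_carrier, of 1 m] by auto
  have "H \<noteq> {\<one>}" using H(2) q(1) by auto
  then obtain h where h: "h \<in> H" "h \<noteq> \<one>" using subgroup.one_closed[OF H(1)] by blast
  have hc: "h \<in> carrier G" using h H subgroup.mem_carrier by metis
  interpret H: group "G\<lparr>carrier := H\<rparr>" using subgroup_imp_group[OF H(1)] .
  have "h [^] q = \<one>"
    using H.pow_order_eq_1[of h] finite_subgroup[OF H(1)] h H(2)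
    by (simp add: order_def nat_pow_consistent[symmetric])
  then have "ord h dvd q" using hc pow_eq_id by blast
  obtain k where k: "ord h = p ^ k" using ord_prime_power hc by blast
  then have "k \<noteq> 0" using h hc ord_eq_1[of h] by (intro notI) simp
  then have "p dvd q" using k \<open>ord h dvd q\<close> dvd_power[of k p] dvd_trans by auto
  then show "q = p" using primes_dvd_imp_eq[OF prime_p q(1)] by simp
qed

text \<open>As \<open>x\<close> and \<open>y\<close> satisfy the defining relations, von Dyck gives
  a homomorphism from \<open>gen_quaternion n\<close>. Its image contains both cosets of
  \<langle>x\<rangle>, and \<open>card_le\<close> then makes it injective.\<close>

lemma quaternion_type_iso:
  assumes "quaternion_type (carrier G)"
  shows "\<exists>n\<ge>3. G \<cong> gen_quaternion n"
proof -
  obtain x y where p: "p = 2" and c: "x \<in> carrier G" "y \<in> carrier G" and yx: "y \<notin> generate G {x}"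
    and yy: "y \<otimes> y = z" and inv: "inv y \<otimes> x \<otimes> y = inv x" and nc: "y \<otimes> x \<noteq> x \<otimes> y"
    and card: "card (carrier G) = 2 * ord x" using assms unfolding quaternion_type_def by blast
  obtain k where k: "ord x = 2 ^ k" using ord_prime_power c p by blast
  have "\<not> k \<le> 1"
    using noncommuting_inverted_ord[OF c(2,1) inv nc] le_imp_power_dvd[of k 1 "2::nat"] k by auto
  \<comment> \<open>\<open>ord x = 2^k\<close> is half the group order, which is therefore
    \<open>2^n\<close>.\<close>
  define n where "n = Suc k"
  have n: "3 \<le> n" using \<open>\<not> k \<le> 1\<close> n_def by simp
  interpret Q: gen_quaternion_group n by unfold_locales (rule n)
  have k2: "2 ^ k = 2 ^ (n - 2) * (2::nat)" using n by (simp add: n_def power_eq_if)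
  \<comment> \<open>With \<open>y^2 = z\<close> this is the second relation; it holds because the
    involution is unique.\<close>
  have "x [^] (2 ^ (n - 2) :: nat) = z"
  proof (rule involution_eq_z[OF p])
    have "(x [^] (2 ^ (n - 2) :: nat)) [^] (2::nat) = \<one>"
      using c k k2 by (simp add: nat_pow_pow pow_eq_id)
    then show "x [^] (2 ^ (n - 2) :: nat) \<otimes> x [^] (2 ^ (n - 2) :: nat) = \<one>"
      using c by (simp add: pow_two)
    have "\<not> ord x dvd 2 ^ (n - 2)" unfolding k k2 by (auto dest!: dvd_imp_le)
    then show "x [^] (2 ^ (n - 2) :: nat) \<noteq> \<one>" using c pow_eq_id by blast
  qed (use c in simp)
  note zx = this
  define \<phi> where "\<phi> = (\<lambda>g. case g of GX \<Rightarrow> x | GY \<Rightarrow> y)"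
  have \<phi>: "range \<phi> \<subseteq> carrier G" using c by (auto simp: \<phi>_def split: gen.split)
  have xpow: "(letter_mult \<phi> GX True ^^ m) \<one> = x [^] m" for m
    using c by (induction m) (simp_all add: letter_mult_def \<phi>_def nat_pow_Suc2[symmetric] del: nat_pow_Suc)
  have "word_act (letter_mult \<phi>) u \<one> = word_act (letter_mult \<phi>) v \<one>" if "(u, v) \<in> quaternion_rels n" for u v
    using that c k zx yy inv
    by (auto simp: quaternion_rels_def word_act_replicate xpow n_def pow_eq_id)
      (simp_all add: letter_mult_def \<phi>_def m_assoc)
  then obtain h where h: "h \<in> hom (presented_group (quaternion_rels n)) G"
    and hw: "\<And>w. h (word_cong (quaternion_rels n) `` {w}) = word_act (letter_mult \<phi>) w \<one>"
    using presented_group_hom[OF \<phi>, of "quaternion_rels n"] by blast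
  have hQ: "h \<in> hom Q.Q G" using h by (simp add: gen_quaternion_rels)
  interpret h: group_hom Q.Q G h using hQ by unfold_locales
  have hx: "h Q.qx = x" "h Q.qy = y"
    using c by (simp_all add: Q.qx_def Q.qy_def hw letter_mult_def \<phi>_def)
  have img: "subgroup (h ` carrier Q.Q) G" using h.img_is_subgroup .
  have xy: "x \<in> h ` carrier Q.Q" "y \<in> h ` carrier Q.Q" using hx Q.gen_closed by (metis imageI)+
  have X: "generate G {x} \<subseteq> h ` carrier Q.Q" using cyclic_subset[OF img xy(1)] .
  have "carrier G \<subseteq> h ` carrier Q.Q"
  proof
    fix g assume g: "g \<in> carrier G"
    show "g \<in> h ` carrier Q.Q"
    proof (cases "g \<in> generate G {x}")
      case False
      have "inv y \<otimes> g \<in> generate G {x}"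
        using index_two_coset[OF finite_carrier cyclic_subgroup[OF c(1)] subgroup_self _ _ c(2) yx g False]
          card card_cyclic[OF c(1)] cyclic_closed[OF c(1)] by auto
      then have "inv y \<otimes> g \<in> h ` carrier Q.Q" using X by blast
      then show ?thesis
        using subgroup_lcancel[OF img subgroup.m_inv_closed[OF img xy(2)] g] by blast
    qed (use X in blast)
  qed
  then have surj: "h ` carrier Q.Q = carrier G" using subgroup.subset[OF img] by blast
  have "card (carrier Q.Q) \<le> card (h ` carrier Q.Q)" using Q.card_le surj card k by (simp add: n_def)
  then have "inj_on h (carrier Q.Q)"
    using card_image_le[OF Q.card_le(1), of h] by (intro eq_card_imp_inj_on[OF Q.card_le(1)]) simp
  then have "h \<in> iso Q.Q G" using hQ surj by (simp add: iso_def bij_betw_def)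
  then have "Q.Q \<cong> G" by (auto simp: is_iso_def)
  then have "G \<cong> Q.Q" by (rule Q.iso_sym)
  then show ?thesis using n by blast
qed

end

text \<open>The isomorphism carries the central involution to an element lying in every nontrivial
  cyclic subgroup, and this one element witnesses all edges.\<close>

lemma complete_if_iso_gen_quaternion:
  assumes G: "group G" and iso: "G \<cong> gen_quaternion n" and n: "3 \<le> n"
  shows "complete_sgraph (generalized_power_graph G)"
proof -
  interpret Q: gen_quaternion_group n by unfold_locales (rule n)
  interpret group G by fact
  obtain f where f: "f \<in> iso Q.Q G" using iso_sym[OF iso] by (auto simp: is_iso_def)
  then have inj: "inj_on f (carrier Q.Q)" and surj: "f ` carrier Q.Q = carrier G"
    and hom: "f \<in> hom Q.Q G" by (auto simp: iso_def bij_betw_def)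
  interpret f: group_hom Q.Q G f using hom by unfold_locales
  let ?z = "Q.qx [^]\<^bsub>Q.Q\<^esub> (2 ^ (n - 2) :: nat)"
  show ?thesis
  proof (rule complete_if_common_element)
    show "f ?z \<noteq> \<one>\<^bsub>G\<^esub>"
      using Q.center_nontrivial inj inj_onD[OF inj, of ?z "\<one>\<^bsub>Q.Q\<^esub>"] by auto
    fix g assume g: "g \<in> carrier G" "g \<noteq> \<one>\<^bsub>G\<^esub>"
    then obtain q where q: "q \<in> carrier Q.Q" "g = f q" using surj by blast
    then have "q \<noteq> \<one>\<^bsub>Q.Q\<^esub>" using g by auto
    then obtain k :: int where "?z = q [^]\<^bsub>Q.Q\<^esub> k"
      using Q.central_involution_in_cyclic q Q.in_cyclic_iff by blast
    then have "f ?z = g [^]\<^bsub>G\<^esub> k" using f.hom_int_pow q by simp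
    then show "f ?z \<in> generate G {g}" using cyclic_pow_mem g by simp
  qed
qed

theorem theorem3p1:
  fixes G :: "('a, 'b) monoid_scheme"
  assumes "group G" and "finite (carrier G)" and "\<not> comm_group G"
  shows "complete_sgraph (generalized_power_graph G) \<longleftrightarrow>
    (\<exists>n::nat. 3 \<le> n \<and> G \<cong> gen_quaternion n)"
proof
  interpret group G by fact
  assume complete: "complete_sgraph (generalized_power_graph G)"
  obtain g where "g \<in> carrier G" "g \<noteq> \<one>\<^bsub>G\<^esub>"
    using assms(3) group_comm_groupI by (metis r_one)
  then obtain p z where "unique_order_p_group G p z"
    using complete_imp_unique_order_p[OF assms(1,2) complete] by blast
  then interpret unique_order_p_group G p z .
  obtain j where j: "card (carrier G) = p ^ j" using card_carrier_prime_power by blast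
  have "\<not> (\<exists>u\<in>carrier G. carrier G = generate G {u})"
    using assms(3) group_comm_groupI cyclic_commute by metis
  then have "quaternion_type (carrier G)"
    using cyclic_or_quaternion_type[OF subgroup_self j] by blast
  then show "\<exists>n::nat. 3 \<le> n \<and> G \<cong> gen_quaternion n" using quaternion_type_iso by blast
next
  assume "\<exists>n::nat. 3 \<le> n \<and> G \<cong> gen_quaternion n"
  then show "complete_sgraph (generalized_power_graph G)"
    using complete_if_iso_gen_quaternion assms(1) by blast
qed

end
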